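(* Let $\{S_n\}$ be a symmetric aperiodic random walk on $\mathbb{Z}^d$ satisfying the moment condition stated in the context, and let $A\subset\mathbb{Z}^d$ be a fixed set. Let $r_n>0$ and $\delta_n>0$ be sequences such that $\delta_n$ is non-increasing, $r_n$ is non-decreasing, for any $c>0$ one has $r_{[cn]}/r_n<C$ with some $C>0$, $\lim_{n\to\infty}r_n^{2d-4}\frac{\log\log n}{\log n}=0$ and $\lim_{n\to\infty}\delta_nr_n^{2d-4}=0$. Put $k_n=(1-\delta_n)\lambda\log n$, $\mathcal{A}_n=\{z\in\mathbb{Z}^d:\xi(z,n)\ge k_n\}$ and $\mathcal{B}_n=\{j\le n:\xi(S_j,\infty)\ge k_n\}$ (indices $0\le j\le n$). (i) If $d\ge5$ and $z_n\in\mathcal{A}_n$, then $$\lim_{n\to\infty}\frac{\sum_{x\in A}\xi(x+z_n,n)}{\log n}=\lambda\sum_{x\in A}m_x\quad\text{almost surely}.$$ (ii) If $d\ge3$ and $j_n\in\mathcal{B}_n$, then $$\lim_{n\to\infty}\frac{\sum_{x\in A}\xi(x+S_{j_n},\infty)}{\log n}=\lambda\sum_{x\in A}m_x\quad\text{almost surely}.$$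
   Context: $S_0=0$, $S_n=\sum_{k=1}^n X_k$, where $X_1,X_2,\dots$ are i.i.d. $\mathbb{Z}^d$-valued with $\mathbf{P}(X_1=x)=p(x)$. Symmetric means $p(x)=p(-x)$ for all $x$. Aperiodic means: with $R^+=\{x\in\mathbb{Z}^d:\mathbf{P}(S_n=x)>0\text{ for some }n\ge0\}$, one has $\{y-z:\ y\in R^+,\,z\in R^+\}=\mathbb{Z}^d$. Moment condition (with $|x|$ the Euclidean norm): $\sum_x|x|^2p(x)<\infty$ if $d=3$; $\sum_x|x|^2\log(|x|+1)p(x)<\infty$ if $d=4$; $\sum_x|x|^{d-2}p(x)<\infty$ if $d\ge5$. $\gamma:=\mathbf{P}(S_i\ne0,\ i=1,2,\dots)$ (which is $>0$ for $d\ge3$), $\gamma_x:=\mathbf{P}(S_i\ne x,\ i=1,2,\dots)$, $\lambda:=-1/\log(1-\gamma)$. $m_0=1$ and $m_x=(1-\gamma_x)^2/(1-\gamma)$ for $x\ne0$. Local time: $\xi(x,n):=\sum_{k=1}^n I\{S_k=x\}$ and $\xi(x,\infty):=\sum_{k=1}^\infty I\{S_k=x\}$. $[\cdot]$ denotes the integer part. For a given realization, the random sets $\mathcal{A}_n$ or $\mathcal{B}_n$ can be empty for some $n$.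
   Formalization: The fixed set A is assumed finite; for infinite A the claim can fail, e.g. A = Z^d with d ≥ 5, where the left side of (i) is n/log n and diverges while the sum of m_x over A is finite. *)

theory Defs
  imports "HOL-Probability.Probability"
begin

(* The dimension d is CARD('d); only X 1, X 2, ... are used, X 0 is unconstrained. *)
locale iid_steps = prob_space M
  for M :: "'w measure" +
  fixes X :: "nat \<Rightarrow> 'w \<Rightarrow> int ^ 'd" and p :: "(int ^ 'd) pmf"
  assumes indep_steps: "indep_vars (\<lambda>_. count_space UNIV) X {1..}"
    and distr_steps: "\<And>k. k \<ge> 1 \<Longrightarrow> distr M (count_space UNIV) (X k) = measure_pmf p"

definition walk :: "(nat \<Rightarrow> 'w \<Rightarrow> int ^ 'd) \<Rightarrow> nat \<Rightarrow> 'w \<Rightarrow> int ^ 'd" where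
  "walk X n \<omega> = (\<Sum>k=1..n. X k \<omega>)"

definition symmetric_step :: "(int ^ 'd) pmf \<Rightarrow> bool" where
  "symmetric_step p \<longleftrightarrow> (\<forall>x. pmf p x = pmf p (- x))"

definition reachable :: "'w measure \<Rightarrow> (nat \<Rightarrow> 'w \<Rightarrow> int ^ 'd) \<Rightarrow> (int ^ 'd) set" where
  "reachable M X = {x. \<exists>n. measure M {\<omega> \<in> space M. walk X n \<omega> = x} > 0}"

definition aperiodic_walk :: "'w measure \<Rightarrow> (nat \<Rightarrow> 'w \<Rightarrow> int ^ 'd) \<Rightarrow> bool" where
  "aperiodic_walk M X \<longleftrightarrow> {y - z |y z. y \<in> reachable M X \<and> z \<in> reachable M X} = UNIV"

definition euclid_norm :: "int ^ 'd \<Rightarrow> real" where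
  "euclid_norm x = norm (\<chi> i. real_of_int (x $ i))"

(* Nothing is required for d < 3. *)
definition moment_condition :: "(int ^ 'd) pmf \<Rightarrow> bool" where
  "moment_condition p \<longleftrightarrow>
     (CARD('d) = 3 \<longrightarrow> (\<lambda>x. euclid_norm x ^ 2 * pmf p x) summable_on UNIV) \<and>
     (CARD('d) = 4 \<longrightarrow>
        (\<lambda>x. euclid_norm x ^ 2 * ln (euclid_norm x + 1) * pmf p x) summable_on UNIV) \<and>
     (CARD('d) \<ge> 5 \<longrightarrow> (\<lambda>x. euclid_norm x ^ (CARD('d) - 2) * pmf p x) summable_on UNIV)"

definition escape_prob :: "'w measure \<Rightarrow> (nat \<Rightarrow> 'w \<Rightarrow> int ^ 'd) \<Rightarrow> int ^ 'd \<Rightarrow> real" where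
  "escape_prob M X x = measure M {\<omega> \<in> space M. \<forall>i\<ge>1. walk X i \<omega> \<noteq> x}"

definition walk_lambda :: "'w measure \<Rightarrow> (nat \<Rightarrow> 'w \<Rightarrow> int ^ 'd) \<Rightarrow> real" where
  "walk_lambda M X = - 1 / ln (1 - escape_prob M X 0)"

definition walk_m :: "'w measure \<Rightarrow> (nat \<Rightarrow> 'w \<Rightarrow> int ^ 'd) \<Rightarrow> int ^ 'd \<Rightarrow> real" where
  "walk_m M X x = (if x = 0 then 1 else (1 - escape_prob M X x)\<^sup>2 / (1 - escape_prob M X 0))"

definition local_time :: "(nat \<Rightarrow> 'w \<Rightarrow> int ^ 'd) \<Rightarrow> int ^ 'd \<Rightarrow> nat \<Rightarrow> 'w \<Rightarrow> real" where
  "local_time X x n \<omega> = (\<Sum>k=1..n. of_bool (walk X k \<omega> = x))"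

(* Extended-real valued, as the number of visits may be infinite on a null set. *)
definition total_local_time :: "(nat \<Rightarrow> 'w \<Rightarrow> int ^ 'd) \<Rightarrow> int ^ 'd \<Rightarrow> 'w \<Rightarrow> ereal" where
  "total_local_time X x \<omega> = (\<Sum>k. of_bool (walk X (Suc k) \<omega> = x))"

definition heavy_level ::
  "'w measure \<Rightarrow> (nat \<Rightarrow> 'w \<Rightarrow> int ^ 'd) \<Rightarrow> (nat \<Rightarrow> real) \<Rightarrow> nat \<Rightarrow> real" where
  "heavy_level M X \<delta> n = (1 - \<delta> n) * walk_lambda M X * ln (real n)"

definition heavy_points ::
  "'w measure \<Rightarrow> (nat \<Rightarrow> 'w \<Rightarrow> int ^ 'd) \<Rightarrow> (nat \<Rightarrow> real) \<Rightarrow> nat \<Rightarrow> 'w \<Rightarrow> (int ^ 'd) set" where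
  "heavy_points M X \<delta> n \<omega> = {z. local_time X z n \<omega> \<ge> heavy_level M X \<delta> n}"

definition heavy_times ::
  "'w measure \<Rightarrow> (nat \<Rightarrow> 'w \<Rightarrow> int ^ 'd) \<Rightarrow> (nat \<Rightarrow> real) \<Rightarrow> nat \<Rightarrow> 'w \<Rightarrow> nat set" where
  "heavy_times M X \<delta> n \<omega> =
     {j. j \<le> n \<and> total_local_time X (walk X j \<omega>) \<omega> \<ge> ereal (heavy_level M X \<delta> n)}"

(* Convergence along those n whose set of candidates H n is nonempty; it holds
   trivially if H n is empty for all large n. *)
definition tendsto_along_nonempty ::
  "(nat \<Rightarrow> 'b::topological_space) \<Rightarrow> 'b \<Rightarrow> (nat \<Rightarrow> 'a set) \<Rightarrow> bool" where
  "tendsto_along_nonempty f l H \<longleftrightarrow>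
     (f \<longlongrightarrow> l) (inf sequentially (principal {n. H n \<noteq> {}}))"

end

theory Submission
  imports Defs
begin

text \<open>Write \<open>q\<close> for the probability of ever returning to the origin and \<open>\<rho>\<close> for the probability of
ever hitting \<open>x \<noteq> 0\<close>, so that \<open>\<lambda> = -1/log q\<close> and \<open>m\<^sub>x = \<rho>^2/q\<close>. The counts of later
visits to \<open>0\<close> and to \<open>x\<close> are governed by a two-parameter family of exponential martingales. Let
\<open>u(y)\<close> be the probability of hitting \<open>0\<close> from \<open>y\<close>. For \<open>\<alpha> \<ge> 0\<close> and
\<open>\<beta> \<ge> -\<alpha>\<rho>\<close> the function \<open>g = 1 + \<alpha> u + \<beta> u(\<cdot> - x)\<close> is at least \<open>1\<close> and
harmonic off \<open>{0, x}\<close>. Hence, with \<open>P\<close> the transition operator and \<open>h = P g\<close>, the quotient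
\<open>w = g/h\<close> equals \<open>1\<close> off these two sites and satisfies \<open>P(w h) = h\<close>, so that
\<open>h(S\<^sub>n) \<Prod>i \<le> n. w(S\<^sub>i)\<close> is a martingale. It multiplies by \<open>e^\<sigma> = w(0)\<close> at each visit
to \<open>0\<close> and by \<open>e^\<tau> = w(x)\<close> at each visit to \<open>x\<close>. The maximal inequality gives a bound of order
\<open>e^(-l)\<close> for the probability that \<open>\<sigma> R\<^sub>m + \<tau> V\<^sub>m \<ge> l\<close> for some \<open>m\<close>, where \<open>R\<^sub>m\<close> and \<open>V\<^sub>m\<close>
count the visits to \<open>0\<close> and \<open>x\<close> up to time \<open>m\<close> (lemmas \<open>tilted_supermartingale\<close> and
\<open>ville_inequality\<close>). The same holds for the walk seen from its position at any time \<open>j\<close>.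

Take \<open>l = c log n\<close> with \<open>c > 1\<close>. A union over the \<open>n\<close> starting times \<open>j \<le> n\<close> costs only a
factor \<open>n\<close>, and Borel-Cantelli along powers of two yields, almost surely and for all large \<open>n\<close>,
the inequality \<open>\<sigma> R\<^sub>m + \<tau> V\<^sub>m < c log n\<close> simultaneously for all starting times \<open>j \<le> n\<close>
and all \<open>m\<close> (\<open>AE_rewards_less_log\<close>). Uniformity in \<open>m\<close> is what allows the local times to be
stopped at \<open>n\<close> as well as at infinity. Starting the count at the first visit to \<open>{z, x + z}\<close>
turns this into a bound on the full local times at \<open>z\<close> and \<open>x + z\<close>
(\<open>local_time_le_of_rewards\<close>).

The value \<open>\<lambda> m\<^sub>x\<close> now comes out of a derivative. With \<open>\<beta> = b \<alpha>\<close> and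
\<open>\<alpha> \<rightarrow> \<infinity>\<close> one has \<open>\<sigma> \<rightarrow> log((1 + b\<rho>) / (q + b\<rho>))\<close> and
\<open>\<tau> \<rightarrow> log((\<rho> + b) / (\<rho> + bq))\<close>, and
\<open>\<lambda>\<sigma> + (\<lambda> m\<^sub>x + \<eta>)\<tau>\<close> has value \<open>1\<close> and derivative \<open>\<eta>(1-q)/\<rho>\<close> at
\<open>b = 0\<close>. So for small \<open>b\<close> of the sign of \<open>\<eta>\<close> it exceeds \<open>1\<close>
(\<open>tilt_parameters_deviation\<close>). Therefore \<open>\<xi>(z) \<ge> (1 - o(1))\<lambda>log n\<close> is incompatible
with \<open>\<xi>(x + z)\<close> lying above \<open>(\<lambda> m\<^sub>x + \<eta>)log n\<close> for \<open>\<eta> > 0\<close>, or below it for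
\<open>\<eta> < 0\<close>.

All this needs \<open>q < 1\<close>. Since the support of the step law generates the lattice, it contains three
linearly independent vectors \<open>w\<^sub>1, w\<^sub>2, w\<^sub>3\<close> when \<open>d \<ge> 3\<close>. Three steps of the walk then dominate
a positive multiple of the step \<open>\<plusminus> w\<^sub>1 \<plusminus> w\<^sub>2 \<plusminus> w\<^sub>3\<close> with independent fair signs, whose
\<open>k\<close>-step probabilities are at most \<open>(k+1)^(-3/2)\<close>. A comparison argument carries the summability
over to the walk (\<open>comparison_green_bounded\<close>, \<open>green_bounded\<close>), and a bounded Green
function forces \<open>return_prob_less_1\<close>.\<close>

section \<open>Averaging operators and a comparison principle\<close>

definition step_mean :: "'a::ab_group_add pmf \<Rightarrow> ('a \<Rightarrow> real) \<Rightarrow> 'a \<Rightarrow> real" where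
  "step_mean p f y = measure_pmf.expectation p (\<lambda>z. f (y + z))"

definition pair_mean :: "'a::ab_group_add \<Rightarrow> ('a \<Rightarrow> real) \<Rightarrow> 'a \<Rightarrow> real" where
  "pair_mean w f y = (f (y + w) + f (y - w)) / 2"

lemma integrable_bounded_pmf:
  fixes f :: "'a \<Rightarrow> real"
  assumes "\<And>z. l \<le> f z" "\<And>z. f z \<le> b"
  shows "integrable (measure_pmf p) f"
proof (rule measure_pmf.integrable_const_bound)
  show "AE z in measure_pmf p. norm (f z) \<le> \<bar>l\<bar> + \<bar>b\<bar>"
  proof (rule AE_pmfI)
    fix z show "norm (f z) \<le> \<bar>l\<bar> + \<bar>b\<bar>"
      using assms(1)[of z] assms(2)[of z] by (auto simp: abs_if)
  qed
qed simp

lemma step_mean_mono: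
  assumes "\<And>z. l \<le> f z" "\<And>z. f z \<le> g z" "\<And>z. g z \<le> b"
  shows "step_mean p f y \<le> step_mean p g y"
  unfolding step_mean_def
proof (rule integral_mono)
  show "integrable (measure_pmf p) (\<lambda>z. f (y + z))"
    by (rule integrable_bounded_pmf[of l _ b]) (use assms order_trans in blast)+
  show "integrable (measure_pmf p) (\<lambda>z. g (y + z))"
    by (rule integrable_bounded_pmf[of l _ b]) (use assms order_trans in blast)+
qed (use assms in auto)

lemma step_mean_const [simp]: "step_mean p (\<lambda>_. c) y = c"
  by (simp add: step_mean_def)

lemma step_mean_bounds:
  assumes "\<And>z. l \<le> f z" "\<And>z. f z \<le> b"
  shows "l \<le> step_mean p f y" "step_mean p f y \<le> b"
  using step_mean_mono[of l "\<lambda>_. l" f b p y] step_mean_mono[of l f "\<lambda>_. b" b p y] assms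
  by auto

lemma step_mean_linear:
  assumes "\<And>z. l \<le> f z" "\<And>z. f z \<le> b" "\<And>z. l' \<le> g z" "\<And>z. g z \<le> b'"
  shows "step_mean p (\<lambda>z. s * f z + t * g z) y = s * step_mean p f y + t * step_mean p g y"
  unfolding step_mean_def
  by (subst Bochner_Integration.integral_add)
     (auto intro!: integrable_mult_right integrable_bounded_pmf assms)

lemma step_mean_translate: "step_mean p (\<lambda>z. f (z + w)) y = step_mean p f (y + w)"
  by (simp add: step_mean_def ac_simps)

lemma step_mean_pair_mean:
  assumes "\<And>z. l \<le> f z" "\<And>z. f z \<le> b"
  shows "step_mean p (pair_mean w f) y = pair_mean w (step_mean p f) y"
proof -
  have "pair_mean w f = (\<lambda>z. (1/2) * f (z + w) + (1/2) * f (z + - w))"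
    by (simp add: pair_mean_def fun_eq_iff)
  then have "step_mean p (pair_mean w f) y =
      (1/2) * step_mean p (\<lambda>z. f (z + w)) y + (1/2) * step_mean p (\<lambda>z. f (z + - w)) y"
    using step_mean_linear[of l "\<lambda>z. f (z + w)" b l "\<lambda>z. f (z + - w)" b p "1/2" "1/2" y] assms
    by simp
  then show ?thesis
    unfolding step_mean_translate by (simp add: pair_mean_def)
qed

lemma pair_mean_bounds:
  assumes "\<And>z. l \<le> f z" "\<And>z. f z \<le> b"
  shows "l \<le> pair_mean w f y" "pair_mean w f y \<le> b"
  using assms(1)[of "y + w"] assms(1)[of "y - w"] assms(2)[of "y + w"] assms(2)[of "y - w"]
  by (auto simp: pair_mean_def)

lemma step_mean_ge_pair_mean:
  assumes "w \<noteq> - w" "pmf p w \<ge> c" "pmf p (- w) \<ge> c" "\<And>z. 0 \<le> f z" "\<And>z. f z \<le> b"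
  shows "2 * c * pair_mean w f y \<le> step_mean p f y"
proof -
  have "c * f (y + w) \<le> pmf p w * f (y + w)" "c * f (y - w) \<le> pmf p (- w) * f (y - w)"
    using assms by (auto intro!: mult_right_mono)
  then have "2 * c * pair_mean w f y \<le> pmf p w * f (y + w) + pmf p (- w) * f (y + - w)"
    by (simp add: pair_mean_def field_simps)
  also have "\<dots> = (\<Sum>z\<in>{w, - w}. f (y + z) * indicator {w, - w} z * pmf p z)"
    using assms(1) by (simp add: ac_simps)
  also have "\<dots> = measure_pmf.expectation p (\<lambda>z. f (y + z) * indicator {w, - w} z)"
    by (subst integral_measure_pmf_real[of "{w, - w}"]) (auto simp: indicator_def)
  also have "\<dots> \<le> step_mean p f y"
    unfolding step_mean_def
  proof (rule integral_mono)
    show "integrable (measure_pmf p) (\<lambda>z. f (y + z) * indicator {w, - w} z)"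
      by (rule integrable_bounded_pmf[of 0 _ b])
         (use assms(4,5) order_trans[OF assms(4,5)] in \<open>auto simp: indicator_def\<close>)
    show "integrable (measure_pmf p) (\<lambda>z. f (y + z))"
      by (rule integrable_bounded_pmf[of 0 _ b]) (use assms in auto)
  qed (use assms in \<open>auto simp: indicator_def\<close>)
  finally show ?thesis .
qed

text \<open>If \<open>Q\<close> dominates \<open>c T\<close>, then \<open>Q = c T + (1-c) N\<close> with \<open>N\<close> again an averaging operator, and expanding
\<open>Q^n\<close> binomially bounds \<open>Q^n f\<close> by a mixture of the bounds \<open>\<alpha>\<^sub>k\<close> on \<open>T^k f\<close>. Summed over \<open>n\<close>, the
weight of each \<open>\<alpha>\<^sub>k\<close> is \<open>\<Sum>n. (n choose k) c^k (1-c)^(n-k) = 1/c\<close>. The binomial expansion is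
replaced by the recursion it satisfies, which needs only that \<open>T\<close> and \<open>Q\<close> commute.\<close>

lemma comparison_green_bounded:
  fixes Q T :: "('a \<Rightarrow> real) \<Rightarrow> 'a \<Rightarrow> real"
  assumes Q: "\<And>f b y. (\<And>z. 0 \<le> f z \<and> f z \<le> b) \<Longrightarrow> 0 \<le> Q f y"
    and QT: "\<And>f b y. (\<And>z. 0 \<le> f z \<and> f z \<le> b) \<Longrightarrow> Q f y \<le> (1 - c) * b + c * T f y"
    and comm: "\<And>f b. (\<And>z. 0 \<le> f z \<and> f z \<le> b) \<Longrightarrow> T (Q f) = Q (T f)"
    and c: "0 < c" "c \<le> 1"
    and f0: "\<And>k z. 0 \<le> (T ^^ k) f0 z \<and> (T ^^ k) f0 z \<le> \<alpha> k"
    and sum: "summable \<alpha>"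
  shows "\<exists>C. \<forall>N y. (\<Sum>n<N. (Q ^^ n) f0 y) \<le> C"
proof -
  define A where "A = rec_nat \<alpha> (\<lambda>_ a k. c * a (Suc k) + (1 - c) * a k)"
  have A0: "A 0 k = \<alpha> k" and AS: "A (Suc n) k = c * A n (Suc k) + (1 - c) * A n k" for n k
    by (simp_all add: A_def)
  have A: "(\<forall>z. 0 \<le> (Q ^^ n) ((T ^^ k) f0) z \<and> (Q ^^ n) ((T ^^ k) f0) z \<le> A n k) \<and>
           T ((Q ^^ n) ((T ^^ k) f0)) = (Q ^^ n) ((T ^^ Suc k) f0)" for n k
  proof (induction n arbitrary: k)
    case 0
    then show ?case using f0 by (simp add: A0)
  next
    case (Suc n)
    let ?f = "(Q ^^ n) ((T ^^ k) f0)"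
    have f: "0 \<le> ?f z \<and> ?f z \<le> A n k" for z using Suc[of k] by blast
    have Tf: "T ?f = (Q ^^ n) ((T ^^ Suc k) f0)" using Suc[of k] by blast
    have "T (Q ?f) = Q (T ?f)" by (rule comm[OF f])
    moreover have "0 \<le> Q ?f z \<and> Q ?f z \<le> A (Suc n) k" for z
    proof
      show "0 \<le> Q ?f z" by (rule Q[OF f])
      have "Q ?f z \<le> (1 - c) * A n k + c * T ?f z" by (rule QT[OF f])
      also have "T ?f z \<le> A n (Suc k)" using Suc[of "Suc k"] unfolding Tf by blast
      finally show "Q ?f z \<le> A (Suc n) k" using c by (simp add: AS mult_left_mono)
    qed
    ultimately show ?case using Tf by simp
  qed
  \<comment> \<open>The total mass started from level \<open>k\<close>, as a solution of \<open>c F k = \<alpha> k + c F (k + 1)\<close>.\<close>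
  define F where "F k = (\<Sum>i. \<alpha> (i + k)) / c" for k
  have F: "c * F k = \<alpha> k + c * F (Suc k)" for k
    using suminf_split_head[of "\<lambda>i. \<alpha> (i + k)"] sum c
    by (simp add: F_def summable_iff_shift)
  have \<alpha>: "0 \<le> \<alpha> k" for k using f0[of k] order_trans by blast
  have F0: "0 \<le> F k" for k
    using \<alpha> c sum by (auto simp: F_def summable_iff_shift intro!: divide_nonneg_pos suminf_nonneg)
  have sumA: "(\<Sum>n<N. A n k) \<le> F k" for N k
  proof (induction N arbitrary: k)
    case 0
    then show ?case using F0 by simp
  next
    case (Suc N)
    have "(\<Sum>n<Suc N. A n k) = \<alpha> k + (\<Sum>n<N. A (Suc n) k)"
      by (subst sum.lessThan_Suc_shift) (simp add: A0)
    also have "\<dots> = \<alpha> k + c * (\<Sum>n<N. A n (Suc k)) + (1 - c) * (\<Sum>n<N. A n k)"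
      by (simp add: AS sum.distrib sum_distrib_left)
    also have "\<dots> \<le> \<alpha> k + c * F (Suc k) + (1 - c) * F k"
      using c by (intro add_mono mult_left_mono Suc) auto
    also have "\<dots> = F k" using F[of k] by (simp add: algebra_simps)
    finally show ?case .
  qed
  have "(\<Sum>n<N. (Q ^^ n) f0 y) \<le> F 0" for N y
  proof -
    have "(\<Sum>n<N. (Q ^^ n) f0 y) \<le> (\<Sum>n<N. A n 0)"
      using A[where k=0] by (intro sum_mono) auto
    then show ?thesis using sumA[of 0 N] order_trans by blast
  qed
  then show ?thesis by blast
qed

section \<open>Decay of a product of three simple random walks\<close>

text \<open>Pascal's rule, split according to parity: after \<open>k\<close> steps the walk sits at \<open>2i - k\<close>, where \<open>i\<close> is the
number of upward steps, and no other integer is reached.\<close>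

lemma pair_mean_funpow_binomial:
  fixes i :: nat
  defines "\<delta> \<equiv> (\<lambda>a::int. of_bool (a = 0) :: real)"
  shows "(pair_mean 1 ^^ k) \<delta> (2 * int i - int k) = real (k choose i) / 2 ^ k"
    and "(\<And>i::nat. a \<noteq> 2 * int i - int k) \<Longrightarrow> (pair_mean 1 ^^ k) \<delta> a = 0"
proof (induction k arbitrary: i a)
  case 0
  { case 1 then show ?case by (cases i) (auto simp: \<delta>_def) }
  { case 2 then show ?case using 2[of 0] by (auto simp: \<delta>_def) }
next
  case (Suc k)
  have step: "(pair_mean 1 ^^ Suc k) \<delta> a =
      ((pair_mean 1 ^^ k) \<delta> (a + 1) + (pair_mean 1 ^^ k) \<delta> (a - 1)) / 2" for a
    by (simp add: pair_mean_def[of 1 "(pair_mean 1 ^^ k) \<delta>"])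
  { case 1
    show ?case
    proof (cases i)
      case 0
      have "(pair_mean 1 ^^ k) \<delta> (2 * int 0 - int k) = real (k choose 0) / 2 ^ k"
        by (rule Suc.IH(1))
      moreover have "(pair_mean 1 ^^ k) \<delta> (- int k - 2) = 0"
        by (rule Suc.IH(2)) auto
      ultimately show ?thesis using 0 unfolding step by (simp add: algebra_simps)
    next
      case (Suc i')
      have "(pair_mean 1 ^^ k) \<delta> (2 * int i - int k) = real (k choose i) / 2 ^ k"
        "(pair_mean 1 ^^ k) \<delta> (2 * int i' - int k) = real (k choose i') / 2 ^ k"
        by (rule Suc.IH(1))+
      then show ?thesis using Suc unfolding step by (simp add: algebra_simps add_divide_distrib)
    qed }
  { case 2
    have "(pair_mean 1 ^^ k) \<delta> (a + 1) = 0"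
      by (rule Suc.IH(2)) (use 2 in \<open>simp add: algebra_simps\<close>)
    moreover have "(pair_mean 1 ^^ k) \<delta> (a - 1) = 0"
    proof (rule Suc.IH(2))
      fix i show "a - 1 \<noteq> 2 * int i - int k"
        using 2[of "Suc i"] by (simp add: algebra_simps)
    qed
    ultimately show ?case unfolding step by simp }
qed

text \<open>Inductively, because the square of the left-hand side times \<open>2m+1\<close> decreases: consecutive values have
ratio \<open>(2m+1)(2m+3)/(2m+2)^2 \<le> 1\<close>.\<close>

lemma central_binomial_upper_bound: "real ((2 * m) choose m) / 4 ^ m \<le> 1 / sqrt (2 * real m + 1)"
proof -
  define c where "c m = real ((2 * m) choose m) / 4 ^ m" for m :: nat
  have step: "c (Suc m) * (2 * real m + 2) = c m * (2 * real m + 1)" for m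
  proof -
    have "Suc m * (2 * Suc m choose Suc m) = (2 * Suc m) * (Suc (2 * m) choose m)"
      using Suc_times_binomial_eq[of "Suc (2*m)" m] by simp
    moreover have "Suc m * (Suc (2 * m) choose m) = Suc (2 * m) * (2 * m choose m)"
      using Suc_times_binomial_eq[of "2*m" m] binomial_symmetric[of "Suc m" "Suc (2*m)"]
      by simp
    ultimately have "real (Suc m) * (2 * Suc m choose Suc m) = 2 * real (Suc m) * (Suc (2 * m) choose m)"
      "real (Suc m) * (Suc (2 * m) choose m) = real (Suc (2 * m)) * (2 * m choose m)"
      by (metis of_nat_mult of_nat_numeral)+
    then have "real (Suc m) * real (2 * Suc m choose Suc m) = 2 * (real (Suc (2 * m)) * real (2 * m choose m))"
      by (metis mult.assoc)
    moreover have "c (Suc m) * (2 * real m + 2) =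
        real (Suc m) * real (2 * Suc m choose Suc m) / (2 * 4 ^ m)"
      by (simp add: c_def field_simps del: binomial_Suc_Suc)
    ultimately show ?thesis by (simp add: c_def field_simps)
  qed
  have sq: "(c m)\<^sup>2 * (2 * real m + 1) \<le> 1" for m
  proof (induction m)
    case 0 then show ?case by (simp add: c_def)
  next
    case (Suc m)
    have "(c (Suc m))\<^sup>2 * (2 * real m + 2)\<^sup>2 = (c m * (2 * real m + 1))\<^sup>2"
      unfolding step[symmetric] by (rule power_mult_distrib[symmetric])
    also have "\<dots> = (c m)\<^sup>2 * (2 * real m + 1) * (2 * real m + 1)"
      by (simp add: power2_eq_square mult_ac)
    also have "\<dots> \<le> 1 * (2 * real m + 1)" using Suc by (intro mult_right_mono) auto
    finally have le: "(c (Suc m))\<^sup>2 * (2 * real m + 2)\<^sup>2 \<le> 2 * real m + 1" by simp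
    have "(c (Suc m))\<^sup>2 * (2 * real (Suc m) + 1) * (2 * real m + 2)\<^sup>2
        = ((c (Suc m))\<^sup>2 * (2 * real m + 2)\<^sup>2) * (2 * real m + 3)"
      by (simp add: algebra_simps)
    also have "\<dots> \<le> (2 * real m + 1) * (2 * real m + 3)" using le by (intro mult_right_mono) auto
    also have "\<dots> \<le> 1 * (2 * real m + 2)\<^sup>2" by (simp add: power2_eq_square algebra_simps)
    finally show ?case by (rule mult_right_le_imp_le) simp
  qed
  have "(c m)\<^sup>2 \<le> (1 / sqrt (2 * real m + 1))\<^sup>2"
    using sq[of m] by (simp add: power_divide field_simps)
  then show ?thesis
    unfolding c_def by (rule power2_le_imp_le) auto
qed

lemma binomial_prob_upper_bound: "real (k choose i) / 2 ^ k \<le> 1 / sqrt (real k + 1)"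
proof (cases "even k")
  case True
  then obtain m where k: "k = 2 * m" by (auto elim: evenE)
  have "real (k choose i) / 2 ^ k \<le> real (2 * m choose m) / 4 ^ m"
    using binomial_maximum'[of m i] by (simp add: k power_mult divide_right_mono)
  also have "\<dots> \<le> 1 / sqrt (real k + 1)"
    using central_binomial_upper_bound[of m] by (simp add: k)
  finally show ?thesis .
next
  case False
  then obtain m where k: "k = 2 * m + 1" by (auto elim: oddE)
  have "(2 * Suc m choose Suc m) = 2 * (k choose m)"
    using binomial_symmetric[of "Suc m" k] by (simp add: k)
  then have "real (k choose m) / 2 ^ k = real (2 * Suc m choose Suc m) / 4 ^ Suc m"
    by (simp add: k power_mult)
  also have "\<dots> \<le> 1 / sqrt (2 * real (Suc m) + 1)" by (rule central_binomial_upper_bound)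
  also have "\<dots> \<le> 1 / sqrt (real k + 1)" by (simp add: k frac_le)
  finally have "real (k choose m) / 2 ^ k \<le> 1 / sqrt (real k + 1)" .
  moreover have "k choose i \<le> k choose m"
    using binomial_maximum[of k i] by (simp add: k)
  then have "real (k choose i) / 2 ^ k \<le> real (k choose m) / 2 ^ k"
    by (simp add: divide_right_mono)
  ultimately show ?thesis by simp
qed

lemma simple_walk_decay:
  "0 \<le> (pair_mean 1 ^^ k) (\<lambda>a::int. of_bool (a = 0)) a"
  "(pair_mean 1 ^^ k) (\<lambda>a::int. of_bool (a = 0)) a \<le> 1 / sqrt (real k + 1)"
proof -
  have "0 \<le> (pair_mean 1 ^^ k) (\<lambda>a::int. of_bool (a = 0)) a \<and>
        (pair_mean 1 ^^ k) (\<lambda>a::int. of_bool (a = 0)) a \<le> 1 / sqrt (real k + 1)"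
  proof (cases "\<exists>i::nat. a = 2 * int i - int k")
    case True
    then obtain i :: nat where "a = 2 * int i - int k" by blast
    then show ?thesis
      using pair_mean_funpow_binomial(1)[of k i] binomial_prob_upper_bound[of k i] by simp
  next
    case False
    then show ?thesis using pair_mean_funpow_binomial(2)[of a k] by simp
  qed
  then show "0 \<le> (pair_mean 1 ^^ k) (\<lambda>a::int. of_bool (a = 0)) a"
    "(pair_mean 1 ^^ k) (\<lambda>a::int. of_bool (a = 0)) a \<le> 1 / sqrt (real k + 1)" by auto
qed

text \<open>Linear independence over the integers, spelled out by coefficients because the lattice is a module and
not a vector space.\<close>

definition int_indep3 :: "int ^ 'd \<Rightarrow> int ^ 'd \<Rightarrow> int ^ 'd \<Rightarrow> bool" where
  "int_indep3 w1 w2 w3 \<longleftrightarrow>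
     (\<forall>a b c. a *s w1 + b *s w2 + c *s w3 = 0 \<longrightarrow> a = 0 \<and> b = 0 \<and> c = 0)"

text \<open>In the coordinates given by the three independent vectors the walk with steps
\<open>\<plusminus> w\<^sub>1 \<plusminus> w\<^sub>2 \<plusminus> w\<^sub>3\<close> is a product of three independent simple random walks, each contributing a
factor of order \<open>k^(-1/2)\<close>. The exponent \<open>3/2 > 1\<close> is where three dimensions enter.\<close>

lemma product_walk_decay:
  fixes w1 w2 w3 :: "int ^ 'd"
  assumes ind: "int_indep3 w1 w2 w3"
  defines "T \<equiv> (\<lambda>f. pair_mean w1 (pair_mean w2 (pair_mean w3 f)))"
  shows "0 \<le> (T ^^ k) (\<lambda>y. of_bool (y = 0)) y \<and>
         (T ^^ k) (\<lambda>y. of_bool (y = 0)) y \<le> (1 / sqrt (real k + 1)) ^ 3"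
proof -
  define e where "e a b c = a *s w1 + b *s w2 + c *s w3" for a b c
  define D where "D = (pair_mean (1::int))"
  \<comment> \<open>\<open>f\<close> lives on the sublattice spanned by the three vectors and is a product in its coordinates.\<close>
  define rep where "rep f \<phi>1 \<phi>2 \<phi>3 \<longleftrightarrow>
     (\<forall>a b c. f (e a b c) = \<phi>1 a * \<phi>2 b * \<phi>3 c) \<and> (\<forall>y. (\<forall>a b c. y \<noteq> e a b c) \<longrightarrow> f y = 0)"
    for f :: "int ^ 'd \<Rightarrow> real" and \<phi>1 \<phi>2 \<phi>3 :: "int \<Rightarrow> real"
  have shift: "e a b c + w1 = e (a + 1) b c" "e a b c - w1 = e (a - 1) b c"
    "e a b c + w2 = e a (b + 1) c" "e a b c - w2 = e a (b - 1) c"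
    "e a b c + w3 = e a b (c + 1)" "e a b c - w3 = e a b (c - 1)" for a b c
    by (auto simp: e_def vec_eq_iff algebra_simps)
  have out: "(\<forall>a b c. y + w \<noteq> e a b c) \<and> (\<forall>a b c. y - w \<noteq> e a b c)"
    if "\<forall>a b c. y \<noteq> e a b c" "w \<in> {w1, w2, w3}" for y w
  proof -
    have "y = e a b c - w" if "y + w = e a b c" for a b c using that by (metis add_diff_cancel)
    moreover have "y = e a b c + w" if "y - w = e a b c" for a b c using that by (metis diff_add_cancel)
    ultimately show ?thesis using that by (elim insertE) (simp_all add: shift, (metis+))
  qed
  have r1: "rep (pair_mean w1 f) (D \<phi>1) \<phi>2 \<phi>3" if "rep f \<phi>1 \<phi>2 \<phi>3" for f \<phi>1 \<phi>2 \<phi>3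
    using that out[where w=w1] unfolding rep_def pair_mean_def D_def
    by (auto simp: shift) (simp_all add: algebra_simps add_divide_distrib)
  have r2: "rep (pair_mean w2 f) \<phi>1 (D \<phi>2) \<phi>3" if "rep f \<phi>1 \<phi>2 \<phi>3" for f \<phi>1 \<phi>2 \<phi>3
    using that out[where w=w2] unfolding rep_def pair_mean_def D_def
    by (auto simp: shift) (simp_all add: algebra_simps add_divide_distrib)
  have r3: "rep (pair_mean w3 f) \<phi>1 \<phi>2 (D \<phi>3)" if "rep f \<phi>1 \<phi>2 \<phi>3" for f \<phi>1 \<phi>2 \<phi>3
    using that out[where w=w3] unfolding rep_def pair_mean_def D_def
    by (auto simp: shift) (simp_all add: algebra_simps add_divide_distrib)
  have T: "rep (T f) (D \<phi>1) (D \<phi>2) (D \<phi>3)" if "rep f \<phi>1 \<phi>2 \<phi>3" for f \<phi>1 \<phi>2 \<phi>3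
    unfolding T_def by (intro r1 r2 r3 that)
  define z where "z = (\<lambda>a::int. of_bool (a = 0) :: real)"
  have "rep ((T ^^ k) (\<lambda>y. of_bool (y = 0))) ((D ^^ k) z) ((D ^^ k) z) ((D ^^ k) z)"
  proof (induction k)
    case 0
    have "e a b c = 0 \<longleftrightarrow> a = 0 \<and> b = 0 \<and> c = 0" for a b c
      using ind unfolding int_indep3_def e_def by auto
    moreover have "y = 0 \<Longrightarrow> y = e 0 0 0" for y by (simp add: e_def)
    ultimately show ?case by (auto simp: rep_def z_def)
  next
    case (Suc k)
    then show ?case using T[OF Suc] by simp
  qed
  then have rep: "(T ^^ k) (\<lambda>y. of_bool (y = 0)) (e a b c) = (D ^^ k) z a * (D ^^ k) z b * (D ^^ k) z c"
    "(\<forall>a b c. y \<noteq> e a b c) \<Longrightarrow> (T ^^ k) (\<lambda>y. of_bool (y = 0)) y = 0" for a b c y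
    unfolding rep_def by auto
  have z: "0 \<le> (D ^^ k) z a" "(D ^^ k) z a \<le> 1 / sqrt (real k + 1)" for a
    using simple_walk_decay unfolding D_def z_def by auto
  show ?thesis
  proof (cases "\<forall>a b c. y \<noteq> e a b c")
    case True
    then show ?thesis using rep(2)[OF True] by simp
  next
    case False
    then obtain a b c where y: "y = e a b c" by blast
    have "(D ^^ k) z a * (D ^^ k) z b * (D ^^ k) z c
        \<le> 1 / sqrt (real k + 1) * (1 / sqrt (real k + 1)) * (1 / sqrt (real k + 1))"
      using z by (intro mult_mono mult_nonneg_nonneg) auto
    then show ?thesis unfolding y rep(1) using z by (simp add: power3_eq_cube)
  qed
qed

lemma summable_decay: "summable (\<lambda>k. (1 / sqrt (real k + 1)) ^ 3)"
proof -
  have "(1 / sqrt (real k + 1)) ^ 3 = real (Suc k) powr (- 3/2)" for k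
  proof -
    have "(1 / sqrt (real k + 1)) ^ 3 = (real (Suc k) powr (- 1/2)) ^ 3"
      by (simp add: powr_minus_divide powr_half_sqrt add.commute)
    also have "\<dots> = real (Suc k) powr (- 3/2)"
      by (simp add: powr_powr flip: powr_realpow)
    finally show ?thesis .
  qed
  moreover have "summable (\<lambda>k. real (Suc k) powr (- 3/2))"
    by (subst summable_Suc_iff) (simp add: summable_real_powr_iff)
  ultimately show ?thesis by simp
qed

section \<open>Boundedness of the Green function in dimension at least three\<close>

locale symmetric_generating_step =
  fixes p :: "(int ^ 'd) pmf"
  assumes sym: "pmf p (- x) = pmf p x"
    and generating: "\<exists>xs. set xs \<subseteq> set_pmf p \<and> sum_list xs = x"
begin

text \<open>The support generates the lattice as a group, hence spans the real space, hence contains a basis of it.\<close>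

lemma independent_support_vectors:
  assumes "CARD('d) \<ge> 3"
  obtains w1 w2 w3 where "{w1, w2, w3} \<subseteq> set_pmf p" "int_indep3 w1 w2 w3"
proof -
  define \<iota> :: "int ^ 'd \<Rightarrow> real ^ 'd" where "\<iota> x = (\<chi> i. real_of_int (x $ i))" for x
  have \<iota>_add: "\<iota> (x + y) = \<iota> x + \<iota> y" and \<iota>_0: "\<iota> 0 = 0" for x y
    by (auto simp: \<iota>_def vec_eq_iff)
  have list: "\<iota> (sum_list xs) \<in> span (\<iota> ` set_pmf p)" if "set xs \<subseteq> set_pmf p" for xs
    using that by (induction xs) (auto simp: \<iota>_add \<iota>_0 span_0 span_base intro!: span_add)
  have "axis i 1 \<in> span (\<iota> ` set_pmf p)" for i
  proof -
    have "\<iota> (axis i 1) = axis i 1" by (auto simp: \<iota>_def axis_def vec_eq_iff)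
    then show ?thesis using generating[of "axis i 1"] list by metis
  qed
  then have "Basis \<subseteq> span (\<iota> ` set_pmf p)"
    by (auto simp: Basis_vec_def)
  then have "span (Basis :: (real ^ 'd) set) \<subseteq> span (\<iota> ` set_pmf p)"
    by (meson span_minimal subspace_span)
  then have "dim (\<iota> ` set_pmf p) = CARD('d)"
    by (metis dim_UNIV DIM_cart DIM_real dim_span mult.right_neutral span_Basis top.extremum_uniqueI)
  then obtain B where B: "B \<subseteq> \<iota> ` set_pmf p" "independent B" "card B = CARD('d)"
    by (metis basis_exists)
  obtain T where T: "T \<subseteq> B" "card T = 3" "finite T"
    using obtain_subset_with_card_n[of 3 B] assms B(3) by metis
  obtain v1 v2 v3 where v: "T = {v1, v2, v3}" "v1 \<noteq> v2" "v2 \<noteq> v3" "v1 \<noteq> v3"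
    using T(2) card_3_iff[of T] by blast
  obtain w1 w2 w3 where w: "v1 = \<iota> w1" "v2 = \<iota> w2" "v3 = \<iota> w3" "{w1, w2, w3} \<subseteq> set_pmf p"
  proof -
    have "v1 \<in> \<iota> ` set_pmf p" "v2 \<in> \<iota> ` set_pmf p" "v3 \<in> \<iota> ` set_pmf p"
      using B(1) T(1) v(1) by auto
    then show ?thesis using that by (auto elim!: imageE)
  qed
  have "int_indep3 w1 w2 w3"
    unfolding int_indep3_def
  proof (intro allI impI)
    fix a b c assume *: "a *s w1 + b *s w2 + c *s w3 = 0"
    define u where "u v = (if v = v1 then real_of_int a else if v = v2 then real_of_int b else real_of_int c)" for v
    have "(\<Sum>v\<in>T. u v *\<^sub>R v) = u v1 *\<^sub>R v1 + u v2 *\<^sub>R v2 + u v3 *\<^sub>R v3"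
      using v by (simp add: add.assoc)
    also have "\<dots> = \<iota> (a *s w1 + b *s w2 + c *s w3)"
      using v by (auto simp: u_def w(1-3) \<iota>_def vec_eq_iff)
    finally have "(\<Sum>v\<in>T. u v *\<^sub>R v) = 0" by (simp add: * \<iota>_0)
    then have "u v = 0" if "v \<in> T" for v
      using independentD[OF B(2) T(3) T(1)] that by blast
    then have "u v1 = 0" "u v2 = 0" "u v3 = 0" by (auto simp: v)
    then show "a = 0 \<and> b = 0 \<and> c = 0" using v by (auto simp: u_def split: if_splits)
  qed
  then show ?thesis using w(4) that by blast
qed

lemma step_mean_sum:
  assumes "\<And>n z. l \<le> f n z" "\<And>n z. f n z \<le> b"
  shows "step_mean p (\<lambda>z. \<Sum>n<N. f n z) y = (\<Sum>n<N. step_mean p (f n) y)"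
  unfolding step_mean_def
  by (rule Bochner_Integration.integral_sum) (auto intro!: integrable_bounded_pmf assms)

lemma step_mean_funpow_bounds:
  assumes "\<And>z. l \<le> f z" "\<And>z. f z \<le> b"
  shows "l \<le> (step_mean p ^^ n) f y \<and> (step_mean p ^^ n) f y \<le> b"
  by (induction n arbitrary: y) (use assms in \<open>auto intro!: step_mean_bounds\<close>)

text \<open>For a nonnegative function, averaging over one step is at least \<open>2 p(w)\<close> times averaging over \<open>\<plusminus> w\<close>.
Three steps therefore dominate a multiple of the product walk, and the comparison principle applies to
the walk observed at multiples of three; the other two residues are obtained by averaging once or
twice more.\<close>

theorem green_bounded:
  assumes "CARD('d) \<ge> 3"
  shows "\<exists>C. \<forall>N y. (\<Sum>n<N. (step_mean p ^^ n) (\<lambda>y. of_bool (y = 0)) y) \<le> C"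
proof -
  let ?P = "step_mean p" and ?\<delta> = "\<lambda>y::int ^ 'd. of_bool (y = 0) :: real"
  obtain w1 w2 w3 where w: "{w1, w2, w3} \<subseteq> set_pmf p" "int_indep3 w1 w2 w3"
    using independent_support_vectors[OF assms] .
  have nz: "w \<noteq> - w" if "w \<in> {w1, w2, w3}" for w
  proof
    assume "w = - w"
    then have "w $ i = 0" for i by (metis equal_neg_zero vector_uminus_component)
    then have "w = 0" by (simp add: vec_eq_iff)
    then have "1 *s w1 + 0 *s w2 + 0 *s w3 = 0 \<or> 0 *s w1 + 1 *s w2 + 0 *s w3 = 0
      \<or> 0 *s w1 + 0 *s w2 + 1 *s w3 = 0"
      using that by auto
    then show False using w(2) unfolding int_indep3_def by (metis zero_neq_one)
  qed
  have lower: "2 * pmf p w * pair_mean w f y \<le> ?P f y"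
    if "w \<in> {w1, w2, w3}" "\<And>z. 0 \<le> f z \<and> f z \<le> b" for w f b y
    using step_mean_ge_pair_mean[of w "pmf p w" p f b y] nz[OF that(1)] that(2) sym by simp
  have half: "0 < 2 * pmf p w \<and> 2 * pmf p w \<le> 1" if "w \<in> {w1, w2, w3}" for w
  proof
    show "0 < 2 * pmf p w" using that w(1) by (auto simp: pmf_positive_iff)
    show "2 * pmf p w \<le> 1" using lower[OF that, of "\<lambda>_. 1" 1 0] by (simp add: pair_mean_def)
  qed
  define c where "c = (2 * pmf p w1) * (2 * pmf p w2) * (2 * pmf p w3)"
  define Q where "Q f = ?P (?P (?P f))" for f
  define T where "T f = pair_mean w1 (pair_mean w2 (pair_mean w3 f))" for f
  have c: "0 < c" "c \<le> 1"
  proof -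
    show "0 < c" unfolding c_def using half[of w1] half[of w2] half[of w3] by simp
    have "2 * pmf p w1 * (2 * pmf p w2) \<le> 1" by (rule mult_le_one) (use half[of w1] half[of w2] half[of w3] in simp_all)
    then show "c \<le> 1" unfolding c_def by (rule mult_le_one) (use half[of w1] half[of w2] half[of w3] in simp_all)
  qed
  have Pb: "0 \<le> ?P f z \<and> ?P f z \<le> b" if "\<And>z. 0 \<le> f z \<and> f z \<le> b" for f b z
    using step_mean_bounds[of 0 f b p z] that by blast
  have Db: "0 \<le> pair_mean w f z \<and> pair_mean w f z \<le> b" if "\<And>z. 0 \<le> f z \<and> f z \<le> b"
    for f b z and w :: "int ^ 'd"
    using pair_mean_bounds[of 0 f b w z] that by blast
  have Q_lower: "c * T f y \<le> Q f y" if f: "\<And>z. 0 \<le> f z \<and> f z \<le> b" for f b y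
  proof -
    have D_mono: "pair_mean w (\<lambda>z. s * g z) y \<le> pair_mean w h y" if "\<And>z. s * g z \<le> h z"
      for w g h s and y :: "int ^ 'd"
      unfolding pair_mean_def using that[of "y + w"] that[of "y - w"] by simp
    have D_scale: "pair_mean w (\<lambda>z. s * g z) y = s * pair_mean w g y" for w g s and y :: "int ^ 'd"
      by (simp add: pair_mean_def algebra_simps add_divide_distrib)
    let ?c3 = "2 * pmf p w3" and ?c2 = "2 * pmf p w2" and ?c1 = "2 * pmf p w1"
    have 1: "?c3 * pair_mean w3 f z \<le> ?P f z" for z by (rule lower[OF _ f]) auto
    have 2: "?c2 * (?c3 * pair_mean w2 (pair_mean w3 f) z) \<le> ?P (?P f) z" for z
    proof -
      have "?c3 * pair_mean w2 (pair_mean w3 f) z \<le> pair_mean w2 (?P f) z"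
        using D_mono[OF 1, where w=w2 and y=z] by (simp add: D_scale)
      then have "?c2 * (?c3 * pair_mean w2 (pair_mean w3 f) z) \<le> ?c2 * pair_mean w2 (?P f) z"
        by (rule mult_left_mono) simp
      also have "\<dots> \<le> ?P (?P f) z" by (rule lower[OF _ Pb[OF f]]) auto
      finally show ?thesis .
    qed
    have "?c2 * ?c3 * pair_mean w1 (pair_mean w2 (pair_mean w3 f)) y \<le> pair_mean w1 (?P (?P f)) y"
      using D_mono[of "?c2 * ?c3" "pair_mean w2 (pair_mean w3 f)" "?P (?P f)" w1 y] 2
      by (simp add: D_scale mult.assoc)
    then have "?c1 * (?c2 * ?c3 * T f y) \<le> ?c1 * pair_mean w1 (?P (?P f)) y"
      unfolding T_def by (rule mult_left_mono) simp
    also have "\<dots> \<le> Q f y"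
      unfolding Q_def by (rule lower[OF _ Pb[OF Pb[OF f]]]) auto
    finally show ?thesis by (simp add: c_def mult.assoc)
  qed
  \<comment> \<open>Apply the lower bound to \<open>b - f\<close>.\<close>
  have Q_upper: "Q f y \<le> (1 - c) * b + c * T f y" if f: "\<And>z. 0 \<le> f z \<and> f z \<le> b" for f b y
  proof -
    have P_compl: "?P (\<lambda>z. b - g z) = (\<lambda>z. b - ?P g z)" if "\<And>z. 0 \<le> g z \<and> g z \<le> b" for g
    proof
      fix z
      show "?P (\<lambda>z. b - g z) z = b - ?P g z"
        using step_mean_linear[of 0 g b 1 "\<lambda>_. 1" 1 p "-1" b z] that by simp
    qed
    have "c * T (\<lambda>z. b - f z) y \<le> Q (\<lambda>z. b - f z) y"
      by (rule Q_lower[of _ b]) (use f in auto)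
    moreover have "T (\<lambda>z. b - f z) y = b - T f y"
      by (simp add: T_def pair_mean_def field_simps)
    moreover have "Q (\<lambda>z. b - f z) y = b - Q f y"
      unfolding Q_def P_compl[OF f] P_compl[OF Pb[OF f]] P_compl[OF Pb[OF Pb[OF f]]] ..
    ultimately show ?thesis by (simp add: algebra_simps)
  qed
  have Q_comm: "T (Q f) = Q (T f)" if f: "\<And>z. 0 \<le> f z \<and> f z \<le> b" for f b
  proof -
    have PD: "?P (pair_mean w g) = pair_mean w (?P g)" if "\<And>z. 0 \<le> g z \<and> g z \<le> b" for g w
      by (rule ext, rule step_mean_pair_mean[of 0 g b]) (use that in auto)
    have PT: "?P (T g) = T (?P g)" if g: "\<And>z. 0 \<le> g z \<and> g z \<le> b" for g
      unfolding T_def PD[OF Db[OF Db[OF g]]] PD[OF Db[OF g]] PD[OF g] ..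
    show ?thesis
      unfolding Q_def PT[OF f] PT[OF Pb[OF f]] PT[OF Pb[OF Pb[OF f]]] ..
  qed
  have "\<exists>C. \<forall>N y. (\<Sum>n<N. (Q ^^ n) ?\<delta> y) \<le> C"
  proof (rule comparison_green_bounded[where T=T and c=c, OF _ Q_upper Q_comm c _ summable_decay])
    show "0 \<le> Q f y" if "\<And>z. 0 \<le> f z \<and> f z \<le> b" for f b y
    proof -
      have "0 \<le> Q f y \<and> Q f y \<le> b" unfolding Q_def by (intro Pb that)
      then show ?thesis ..
    qed
    show "0 \<le> (T ^^ k) ?\<delta> z \<and> (T ^^ k) ?\<delta> z \<le> (1 / sqrt (real k + 1)) ^ 3" for k z
      using product_walk_decay[OF w(2), of k z] unfolding T_def[abs_def] .
  qed auto
  then obtain C where C: "\<And>N y. (\<Sum>n<N. (Q ^^ n) ?\<delta> y) \<le> C" by blast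
  have \<delta>: "0 \<le> (?P ^^ n) ?\<delta> y" "(?P ^^ n) ?\<delta> y \<le> 1" for n y
    using step_mean_funpow_bounds[of 0 ?\<delta> 1 n y] by auto
  have QP: "(Q ^^ n) = (?P ^^ (3 * n))" for n
  proof -
    have "Q = ?P ^^ 3" by (auto simp: Q_def numeral_3_eq_3)
    then show ?thesis by (simp add: funpow_mult)
  qed
  have S0: "(\<Sum>n<N. (?P ^^ (3 * n)) ?\<delta> y) \<le> C" for N y
    using C[where N=N and y=y] by (simp add: QP)
  have nn: "0 \<le> (\<Sum>n<N. (?P ^^ (3 * n)) ?\<delta> y)" for N y
    by (intro sum_nonneg \<delta>)
  have P1: "?P (\<lambda>z. \<Sum>n<N. f n z) y \<le> C" and P0: "0 \<le> ?P (\<lambda>z. \<Sum>n<N. f n z) y"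
    if "\<And>y. (\<Sum>n<N. f n y) \<le> C" "\<And>y. 0 \<le> (\<Sum>n<N. f n y)" for N y and f :: "nat \<Rightarrow> int ^ 'd \<Rightarrow> real"
    using step_mean_bounds[of 0 "\<lambda>z. \<Sum>n<N. f n z" C p y] that by auto
  have S1: "(\<Sum>n<N. (?P ^^ Suc (3 * n)) ?\<delta> y) \<le> C" for N y
    using P1[where f="\<lambda>n. (?P ^^ (3 * n)) ?\<delta>" and N=N and y=y, OF S0 nn]
      step_mean_sum[of 0 "\<lambda>n. (?P ^^ (3 * n)) ?\<delta>" 1 N y] \<delta> by simp
  have S2: "(\<Sum>n<N. (?P ^^ Suc (Suc (3 * n))) ?\<delta> y) \<le> C" for N y
    using P1[where f="\<lambda>n. (?P ^^ Suc (3 * n)) ?\<delta>" and N=N and y=y, OF S1 sum_nonneg[OF \<delta>(1)]]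
      step_mean_sum[of 0 "\<lambda>n. (?P ^^ Suc (3 * n)) ?\<delta>" 1 N y] \<delta>[of "Suc (3 * _)"] by simp
  have split3: "(\<Sum>n<3 * N. a n) =
      (\<Sum>n<N. a (3 * n)) + (\<Sum>n<N. a (Suc (3 * n))) + (\<Sum>n<N. a (Suc (Suc (3 * n))))"
    for a :: "nat \<Rightarrow> real" and N
  proof (induction N)
    case (Suc N)
    have e: "3 * Suc N = Suc (Suc (Suc (3 * N)))" by simp
    show ?case unfolding e using Suc by simp
  qed simp
  have "(\<Sum>n<N. (?P ^^ n) ?\<delta> y) \<le> 3 * C" for N y
  proof -
    have "(\<Sum>n<N. (?P ^^ n) ?\<delta> y) \<le> (\<Sum>n<3 * N. (?P ^^ n) ?\<delta> y)"
      by (rule sum_mono2) (auto intro: \<delta>)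
    also have "\<dots> = (\<Sum>n<N. (?P ^^ (3 * n)) ?\<delta> y) + (\<Sum>n<N. (?P ^^ Suc (3 * n)) ?\<delta> y)
       + (\<Sum>n<N. (?P ^^ Suc (Suc (3 * n))) ?\<delta> y)"
      by (rule split3)
    also have "\<dots> \<le> 3 * C" using S0[where N=N and y=y] S1[where N=N and y=y] S2[where N=N and y=y] by linarith
    finally show ?thesis .
  qed
  then show ?thesis by blast
qed

end

section \<open>Hitting probabilities\<close>

text \<open>The probability, started from \<open>y\<close>, of visiting \<open>0\<close> at one of the times \<open>0, ..., n\<close>.\<close>

primrec hit_within :: "'a::ab_group_add pmf \<Rightarrow> nat \<Rightarrow> 'a \<Rightarrow> real" where
  "hit_within p 0 = (\<lambda>y. of_bool (y = 0))"
| "hit_within p (Suc n) = (\<lambda>y. if y = 0 then 1 else step_mean p (hit_within p n) y)"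

definition hit_prob :: "'a::ab_group_add pmf \<Rightarrow> 'a \<Rightarrow> real" where
  "hit_prob p y = lim (\<lambda>n. hit_within p n y)"

text \<open>Harmonicity of the hitting probability fails only at the origin; averaging it there over one
step gives the probability of a return at a positive time.\<close>

definition return_prob :: "'a::ab_group_add pmf \<Rightarrow> real" where
  "return_prob p = step_mean p (hit_prob p) 0"

lemma hit_within_0 [simp]: "hit_within p n 0 = 1"
  by (cases n) auto

lemma hit_within_bounds: "0 \<le> hit_within p n y" "hit_within p n y \<le> 1"
proof -
  have "0 \<le> hit_within p n y \<and> hit_within p n y \<le> 1"
    by (induction n arbitrary: y) (auto intro: step_mean_bounds)
  then show "0 \<le> hit_within p n y" "hit_within p n y \<le> 1" by auto
qed

lemma hit_within_mono: "hit_within p n y \<le> hit_within p (Suc n) y"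
proof (induction n arbitrary: y)
  case 0
  then show ?case using step_mean_bounds(1)[of 0 "\<lambda>y. of_bool (y = 0)" 1 p y] by auto
next
  case (Suc n)
  then have "step_mean p (hit_within p n) y \<le> step_mean p (hit_within p (Suc n)) y"
    by (rule step_mean_mono[of 0 _ _ 1, OF hit_within_bounds(1) _ hit_within_bounds(2)])
  then show ?case
    unfolding hit_within.simps(2)[of p n] hit_within.simps(2)[of p "Suc n"] by auto
qed

lemma hit_within_LIMSEQ: "(\<lambda>n. hit_within p n y) \<longlonglongrightarrow> hit_prob p y"
  unfolding hit_prob_def convergent_LIMSEQ_iff[symmetric]
proof (rule Bseq_monoseq_convergent)
  show "Bseq (\<lambda>n. hit_within p n y)"
    using hit_within_bounds[of p _ y] by (intro BseqI'[of _ 1]) auto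
  show "monoseq (\<lambda>n. hit_within p n y)"
    using hit_within_mono[of p _ y] by (auto simp: monoseq_Suc)
qed

lemma hit_prob_bounds: "0 \<le> hit_prob p y" "hit_prob p y \<le> 1"
  using LIMSEQ_le_const[OF hit_within_LIMSEQ] LIMSEQ_le_const2[OF hit_within_LIMSEQ]
    hit_within_bounds by blast+

lemma hit_prob_0 [simp]: "hit_prob p 0 = 1"
  using LIMSEQ_unique[OF hit_within_LIMSEQ[of p 0]] by simp

lemma step_mean_LIMSEQ:
  assumes "\<And>z. (\<lambda>n. f n z) \<longlonglongrightarrow> g z" "\<And>n z. \<bar>f n z\<bar> \<le> b"
  shows "(\<lambda>n. step_mean p (f n) y) \<longlonglongrightarrow> step_mean p g y"
  unfolding step_mean_def
  by (rule integral_dominated_convergence[where w="\<lambda>_. b"]) (use assms in auto)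

lemma step_mean_hit_within_LIMSEQ:
  "(\<lambda>n. step_mean p (hit_within p n) y) \<longlonglongrightarrow> step_mean p (hit_prob p) y"
proof (rule step_mean_LIMSEQ[OF hit_within_LIMSEQ])
  show "\<bar>hit_within p n z\<bar> \<le> 1" for n z using hit_within_bounds[of p n z] by simp
qed

lemma hit_prob_harmonic:
  assumes "y \<noteq> 0"
  shows "step_mean p (hit_prob p) y = hit_prob p y"
proof (rule LIMSEQ_unique[OF step_mean_hit_within_LIMSEQ])
  show "(\<lambda>n. step_mean p (hit_within p n) y) \<longlonglongrightarrow> hit_prob p y"
    using LIMSEQ_Suc[OF hit_within_LIMSEQ[of p y]] assms by simp
qed

lemma return_prob_le_1: "return_prob p \<le> 1"
  unfolding return_prob_def using step_mean_bounds(2) hit_prob_bounds by metis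

lemma hit_prob_superharmonic: "step_mean p (hit_prob p) y \<le> hit_prob p y"
  using hit_prob_harmonic[of y p] return_prob_le_1[of p] by (cases "y = 0") (auto simp: return_prob_def)

text \<open>Hitting probabilities are the least bounded nonnegative superharmonic functions with value \<open>1\<close> at the
origin. Comparing them with other superharmonic functions through this takes the place of the strong
Markov property.\<close>

lemma hit_prob_minimal:
  assumes f: "\<And>z. 0 \<le> f z" "\<And>z. f z \<le> b" and super: "\<And>z. step_mean p f z \<le> f z"
  shows "hit_prob p y * f 0 \<le> f y"
proof -
  have "hit_within p n y * f 0 \<le> f y" for n
  proof (induction n arbitrary: y)
    case 0
    then show ?case using f by auto
  next
    case (Suc n)
    have "step_mean p (\<lambda>z. f 0 * hit_within p n z + 0 * (\<lambda>_. 0) z) y = f 0 * step_mean p (hit_within p n) y"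
      by (subst step_mean_linear[of 0 _ 1 0 _ 0]) (auto simp: hit_within_bounds)
    moreover have "step_mean p (\<lambda>z. f 0 * hit_within p n z) y \<le> step_mean p f y"
      by (rule step_mean_mono[of 0 _ _ b])
        (use Suc f in \<open>auto simp: mult.commute hit_within_bounds\<close>)
    ultimately have "f 0 * step_mean p (hit_within p n) y \<le> f y"
      using super[of y] by simp
    then show ?case by (auto simp: mult.commute)
  qed
  then show ?thesis
    by (intro LIMSEQ_le_const2[OF tendsto_mult_right[OF hit_within_LIMSEQ]]) auto
qed

lemma hit_prob_triangle: "hit_prob p (y - x) * hit_prob p x \<le> hit_prob p y"
  using hit_prob_minimal[of "\<lambda>z. hit_prob p (z + x)" 1 p "y - x"]
  by (simp add: hit_prob_bounds step_mean_translate hit_prob_superharmonic)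

context symmetric_generating_step
begin

lemma map_uminus_step: "map_pmf uminus p = p"
proof (rule pmf_eqI)
  fix x
  show "pmf (map_pmf uminus p) x = pmf p x"
    using pmf_map_inj'[of uminus p "- x"] by (simp add: sym)
qed

lemma step_mean_uminus: "step_mean p (\<lambda>z. f (- z)) y = step_mean p f (- y)"
proof -
  have "step_mean p f (- y) = measure_pmf.expectation (map_pmf uminus p) (\<lambda>z. f (- y + z))"
    by (simp add: step_mean_def map_uminus_step)
  moreover have "- y + - z = - (y + z)" for z by simp
  ultimately show ?thesis by (simp only: step_mean_def integral_map_pmf)
qed

lemma hit_within_uminus: "hit_within p n (- y) = hit_within p n y"
proof (induction n arbitrary: y)
  case (Suc n)
  have "step_mean p (hit_within p n) (- y) = step_mean p (\<lambda>z. hit_within p n (- z)) y"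
    by (rule step_mean_uminus[symmetric])
  then show ?case using Suc by (simp cong: if_cong)
qed simp

lemma hit_prob_uminus: "hit_prob p (- y) = hit_prob p y"
  by (simp add: hit_prob_def hit_within_uminus)

lemma step_mean_ge_pmf:
  assumes "\<And>z. 0 \<le> f z" "\<And>z. f z \<le> b"
  shows "pmf p z * f (y + z) \<le> step_mean p f y"
proof -
  have "pmf p z * f (y + z) = measure_pmf.expectation p (\<lambda>x. f (y + x) * indicator {z} x)"
    by (subst integral_measure_pmf_real[of "{z}"]) (auto simp: indicator_def)
  also have "\<dots> \<le> step_mean p f y"
    unfolding step_mean_def
  proof (rule integral_mono)
    show "integrable (measure_pmf p) (\<lambda>x. f (y + x) * indicator {z} x)"
      by (rule integrable_bounded_pmf[of 0 _ b])
         (use assms order_trans[OF assms] in \<open>auto simp: indicator_def\<close>)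
    show "integrable (measure_pmf p) (\<lambda>z. f (y + z))"
      by (rule integrable_bounded_pmf[of 0 _ b]) (use assms in auto)
  qed (use assms in \<open>auto simp: indicator_def\<close>)
  finally show ?thesis .
qed

lemma hit_prob_pos: "0 < hit_prob p y"
proof -
  have "0 < hit_prob p (- sum_list xs)" if "set xs \<subseteq> set_pmf p" for xs
    using that
  proof (induction xs)
    case (Cons x xs)
    have "0 < pmf p x * hit_prob p (- sum_list (x # xs) + x)"
      using Cons by (simp add: pmf_positive_iff)
    also have "\<dots> \<le> step_mean p (hit_prob p) (- sum_list (x # xs))"
      by (rule step_mean_ge_pmf[of _ 1]) (auto simp: hit_prob_bounds)
    also have "\<dots> \<le> hit_prob p (- sum_list (x # xs))" by (rule hit_prob_superharmonic)
    finally show ?case .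
  qed simp
  then show ?thesis using generating[of "- y"] by (metis minus_minus)
qed

lemma return_prob_pos: "0 < return_prob p"
proof -
  obtain x where x: "x \<in> set_pmf p" using set_pmf_not_empty[of p] by blast
  then have "0 < pmf p x * hit_prob p (0 + x)"
    using hit_prob_pos by (simp add: pmf_positive_iff)
  also have "\<dots> \<le> return_prob p"
    unfolding return_prob_def by (rule step_mean_ge_pmf[of _ 1]) (auto simp: hit_prob_bounds)
  finally show ?thesis .
qed

text \<open>The Green function \<open>G\<close> is superharmonic with a defect of exactly \<open>1\<close> at the origin. By minimality the
hitting probability is at most \<open>G/G(0)\<close>, and one step from the origin gives
\<open>q \<le> 1 - 1/G(0)\<close>.\<close>

theorem return_prob_less_1:
  assumes "CARD('d) \<ge> 3"
  shows "return_prob p < 1"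
proof -
  let ?P = "step_mean p" and ?\<delta> = "\<lambda>y::int ^ 'd. of_bool (y = 0) :: real"
  obtain C where C: "\<And>N y. (\<Sum>n<N. (?P ^^ n) ?\<delta> y) \<le> C"
    using green_bounded[OF assms] by blast
  have \<delta>: "0 \<le> (?P ^^ n) ?\<delta> y" "(?P ^^ n) ?\<delta> y \<le> 1" for n y
    using step_mean_funpow_bounds[of 0 ?\<delta> 1 n y] by auto
  define G where "G y = (\<Sum>n. (?P ^^ n) ?\<delta> y)" for y
  have summ: "summable (\<lambda>n. (?P ^^ n) ?\<delta> y)" for y
  proof (rule bounded_imp_summable[OF \<delta>(1)])
    show "(\<Sum>n\<le>N. (?P ^^ n) ?\<delta> y) \<le> C" for N
      using C[where N="Suc N" and y=y] unfolding lessThan_Suc_atMost .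
  qed
  have lim: "(\<lambda>N. \<Sum>n<N. (?P ^^ n) ?\<delta> y) \<longlonglongrightarrow> G y" for y
    unfolding G_def by (rule summable_LIMSEQ[OF summ])
  have G: "0 \<le> G y" "G y \<le> C" for y
    unfolding G_def by (rule suminf_nonneg[OF summ \<delta>(1)], rule suminf_le_const[OF summ C])
  have PG: "?P G y = G y - ?\<delta> y" for y
  proof (rule LIMSEQ_unique)
    show "(\<lambda>N. ?P (\<lambda>z. \<Sum>n<N. (?P ^^ n) ?\<delta> z) y) \<longlonglongrightarrow> ?P G y"
      by (rule step_mean_LIMSEQ[where b=C]) (use lim C \<delta> in \<open>auto simp: sum_nonneg\<close>)
    have "?P (\<lambda>z. \<Sum>n<N. (?P ^^ n) ?\<delta> z) y = (\<Sum>n<Suc N. (?P ^^ n) ?\<delta> y) - ?\<delta> y" for N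
    proof -
      have "?P (\<lambda>z. \<Sum>n<N. (?P ^^ n) ?\<delta> z) y = (\<Sum>n<N. ?P ((?P ^^ n) ?\<delta>) y)"
        by (rule step_mean_sum[of 0 _ 1]) (use \<delta> in auto)
      then show ?thesis by (subst sum.lessThan_Suc_shift) simp
    qed
    then show "(\<lambda>N. ?P (\<lambda>z. \<Sum>n<N. (?P ^^ n) ?\<delta> z) y) \<longlonglongrightarrow> G y - ?\<delta> y"
      using tendsto_diff[OF LIMSEQ_Suc[OF lim[of y]] tendsto_const[of "?\<delta> y"]] by simp
  qed
  have G0: "1 \<le> G 0" using PG[of 0] step_mean_bounds(1)[of 0 G C p 0] G by simp
  have le: "hit_prob p y \<le> G y / G 0" for y
  proof -
    have "hit_prob p y * G 0 \<le> G y"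
      by (rule hit_prob_minimal[of G C]) (use G PG in auto)
    then show ?thesis using G0 by (simp add: field_simps)
  qed
  have "return_prob p \<le> ?P (\<lambda>z. G z / G 0) 0"
    unfolding return_prob_def
    by (rule step_mean_mono[of 0 _ _ "C / G 0"]) (use G G0 le hit_prob_bounds in \<open>auto simp: divide_right_mono\<close>)
  also have "\<dots> = ?P G 0 / G 0"
    by (simp add: step_mean_def)
  also have "\<dots> < 1" using PG[of 0] G0 by (simp add: field_simps)
  finally show ?thesis .
qed

end

section \<open>Tilted supermartingales and exponential deviation bounds\<close>

lemma measure_replicate_pmf_Suc:
  "measure (replicate_pmf (Suc n) p) E =
     measure_pmf.expectation p (\<lambda>x. measure (replicate_pmf n p) {xs. x # xs \<in> E})"
proof -
  have "emeasure (replicate_pmf (Suc n) p) E =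
      (\<integral>\<^sup>+ x. emeasure (replicate_pmf n p) {xs. x # xs \<in> E} \<partial>p)"
    by (simp add: vimage_def flip: map_pmf_def)
  also have "\<dots> = (\<integral>\<^sup>+ x. ennreal (measure (replicate_pmf n p) {xs. x # xs \<in> E}) \<partial>p)"
    by (simp add: measure_pmf.emeasure_eq_measure)
  also have "\<dots> = ennreal (measure_pmf.expectation p (\<lambda>x. measure (replicate_pmf n p) {xs. x # xs \<in> E}))"
    by (intro nn_integral_eq_integral integrable_bounded_pmf[of 0 _ 1]) auto
  finally show ?thesis
    by (simp add: measure_pmf.emeasure_eq_measure integral_nonneg_AE)
qed

text \<open>A maximal inequality for the supermartingale \<open>h(S\<^sub>m) exp \<Sum>i \<le> m. f(S\<^sub>i)\<close>, where \<open>h \<ge> 1\<close> makes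
the exponential itself controllable. It is proved by induction on the horizon, conditioning on the
first step: if the level is not yet reached, that step multiplies the bound by \<open>e^(f) h\<close> at the
new position, and the supermartingale property averages this back.\<close>

lemma ville_inequality:
  fixes f h :: "'a::ab_group_add \<Rightarrow> real"
  assumes h: "\<And>z. 1 \<le> h z"
    and super: "\<And>z. step_mean p (\<lambda>z. exp (f z) * h z) z \<le> h z"
    and bdd: "\<And>z. exp (f z) * h z \<le> B"
  shows "measure (replicate_pmf n p)
           {xs. \<exists>m\<le>n. l \<le> (\<Sum>i<m. f (y + sum_list (take (Suc i) xs)))} \<le> h y * exp (- l)"
proof (induction n arbitrary: l y)
  case 0
  show ?case
  proof (cases "l \<le> 0")
    case True
    then have "1 * 1 \<le> h y * exp (- l)" using h[of y] by (intro mult_mono) auto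
    then show ?thesis by (intro order_trans[OF measure_pmf.prob_le_1]) simp
  next
    case False
    then show ?thesis using h[of y] by simp
  qed
next
  case (Suc n)
  show ?case
  proof (cases "l \<le> 0")
    case True
    then have "1 * 1 \<le> h y * exp (- l)" using h[of y] by (intro mult_mono) auto
    then show ?thesis by (intro order_trans[OF measure_pmf.prob_le_1]) simp
  next
    case False
    let ?E = "\<lambda>n l y. {xs. \<exists>m\<le>n. l \<le> (\<Sum>i<m. f (y + sum_list (take (Suc i) xs)))}"
    have sub: "{xs. x # xs \<in> ?E (Suc n) l y} \<subseteq> ?E n (l - f (y + x)) (y + x)" for x
    proof
      fix xs assume "xs \<in> {xs. x # xs \<in> ?E (Suc n) l y}"
      then obtain m where m: "m \<le> Suc n" "l \<le> (\<Sum>i<m. f (y + sum_list (take (Suc i) (x # xs))))"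
        by blast
      obtain k where k: "m = Suc k" using m False by (cases m) auto
      have "l - f (y + x) \<le> (\<Sum>i<k. f (y + x + sum_list (take (Suc i) xs)))"
        using m(2) unfolding k sum.lessThan_Suc_shift by (simp add: add.assoc)
      then show "xs \<in> ?E n (l - f (y + x)) (y + x)" using m(1) k by auto
    qed
    have step: "measure (replicate_pmf n p) {xs. x # xs \<in> ?E (Suc n) l y}
        \<le> exp (- l) * (exp (f (y + x)) * h (y + x))" for x
    proof -
      have "measure (replicate_pmf n p) {xs. x # xs \<in> ?E (Suc n) l y}
          \<le> measure (replicate_pmf n p) (?E n (l - f (y + x)) (y + x))"
        by (rule measure_pmf.finite_measure_mono[OF sub]) simp
      also have "\<dots> \<le> h (y + x) * exp (- (l - f (y + x)))" by (rule Suc)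
      also have "\<dots> = exp (- l) * (exp (f (y + x)) * h (y + x))"
        by (simp add: exp_diff exp_minus field_simps)
      finally show ?thesis .
    qed
    have h0: "0 \<le> exp (f z) * h z" for z using h[of z] by simp
    have "measure (replicate_pmf (Suc n) p) (?E (Suc n) l y)
        \<le> measure_pmf.expectation p (\<lambda>x. exp (- l) * (exp (f (y + x)) * h (y + x)))"
      unfolding measure_replicate_pmf_Suc
    proof (rule integral_mono)
      show "integrable (measure_pmf p)
          (\<lambda>x. measure (replicate_pmf n p) {xs. x # xs \<in> ?E (Suc n) l y})"
        by (rule integrable_bounded_pmf[of 0 _ 1]) auto
      show "integrable (measure_pmf p) (\<lambda>x. exp (- l) * (exp (f (y + x)) * h (y + x)))"
        by (intro integrable_mult_right integrable_bounded_pmf[of 0 _ B] h0 bdd)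
    qed (rule step)
    also have "\<dots> = exp (- l) * step_mean p (\<lambda>z. exp (f z) * h z) y"
      by (simp add: step_mean_def)
    also have "\<dots> \<le> h y * exp (- l)" using super[of y] by simp
    finally show ?thesis .
  qed
qed

text \<open>Summed along a path, this is \<open>\<sigma>\<close> times the number of visits to \<open>0\<close> plus \<open>\<tau>\<close> times the number
of visits to \<open>x\<close>.\<close>

definition two_site_reward :: "real \<Rightarrow> real \<Rightarrow> 'a::ab_group_add \<Rightarrow> 'a \<Rightarrow> real" where
  "two_site_reward \<sigma> \<tau> x y = \<sigma> * of_bool (y = 0) + \<tau> * of_bool (y = x)"

text \<open>With \<open>g = 1 + \<alpha> u + \<beta> u(\<cdot> - x)\<close> and \<open>h\<close> its one-step average, the tilt must be \<open>g/h\<close>. This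
quotient differs from \<open>1\<close> only at \<open>0\<close> and \<open>x\<close>, and evaluating it there gives the formulas for \<open>\<sigma>\<close>
and \<open>\<tau>\<close>. The lower bound on \<open>\<beta>\<close> keeps \<open>g \<ge> 1\<close>, by \<open>hit_prob_triangle\<close>.\<close>

lemma (in symmetric_generating_step) tilted_supermartingale:
  fixes x :: "int ^ 'd" and \<alpha> \<beta> :: real
  defines "q \<equiv> return_prob p" and "\<rho> \<equiv> hit_prob p x"
  defines "\<sigma> \<equiv> ln ((1 + \<alpha> + \<beta> * \<rho>) / (1 + \<alpha> * q + \<beta> * \<rho>))"
    and "\<tau> \<equiv> ln ((1 + \<alpha> * \<rho> + \<beta>) / (1 + \<alpha> * \<rho> + \<beta> * q))"
  assumes x: "x \<noteq> 0" and \<alpha>: "0 \<le> \<alpha>" and \<beta>: "- (\<alpha> * \<rho>) \<le> \<beta>"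
  obtains h B where "\<And>z. 1 \<le> h z"
    "\<And>z. step_mean p (\<lambda>z. exp (two_site_reward \<sigma> \<tau> x z) * h z) z \<le> h z"
    "\<And>z. exp (two_site_reward \<sigma> \<tau> x z) * h z \<le> B"
proof -
  let ?u = "hit_prob p"
  define v where "v z = ?u (z - x)" for z
  define g where "g z = 1 + (\<alpha> * ?u z + \<beta> * v z)" for z
  define h where "h = step_mean p g"
  define B where "B = 1 + \<alpha> + \<bar>\<beta>\<bar>"
  have v: "0 \<le> v z" "v z \<le> 1" for z by (simp_all add: v_def hit_prob_bounds)
  have g1: "1 \<le> g z" for z
  proof -
    have "\<rho> * v z \<le> ?u z" using hit_prob_triangle[of p z x] by (simp add: v_def \<rho>_def mult.commute)
    then have "\<alpha> * (\<rho> * v z) \<le> \<alpha> * ?u z" using \<alpha> by (rule mult_left_mono)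
    moreover have "- (\<alpha> * \<rho>) * v z \<le> \<beta> * v z" using \<beta> v by (intro mult_right_mono)
    ultimately show ?thesis by (simp add: g_def)
  qed
  have gB: "g z \<le> B" for z
  proof -
    have "\<alpha> * ?u z \<le> \<alpha> * 1" using \<alpha> hit_prob_bounds by (intro mult_left_mono)
    moreover have "\<beta> * v z \<le> \<bar>\<beta>\<bar> * 1" using v by (intro mult_mono) auto
    ultimately show ?thesis by (simp add: g_def B_def)
  qed
  have h1: "1 \<le> h z" for z
    unfolding h_def using step_mean_bounds(1)[of 1 g B p z] g1 gB by auto
  have lin: "h z = 1 + (\<alpha> * step_mean p ?u z + \<beta> * step_mean p v z)" for z
  proof -
    have *: "0 \<le> \<alpha> * ?u z + \<beta> * v z" "\<alpha> * ?u z + \<beta> * v z \<le> B" for z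
      using g1[of z] gB[of z] by (simp_all add: g_def)
    have "h z = 1 * step_mean p (\<lambda>_. 1) z + 1 * step_mean p (\<lambda>z. \<alpha> * ?u z + \<beta> * v z) z"
      using step_mean_linear[of 1 "\<lambda>_. 1" 1 0 "\<lambda>z. \<alpha> * ?u z + \<beta> * v z" B p 1 1 z] *
      by (simp add: h_def g_def[abs_def])
    also have "step_mean p (\<lambda>z. \<alpha> * ?u z + \<beta> * v z) z = \<alpha> * step_mean p ?u z + \<beta> * step_mean p v z"
      by (rule step_mean_linear[of 0 _ 1 0 _ 1]) (auto simp: v hit_prob_bounds)
    finally show ?thesis by simp
  qed
  have Pv: "step_mean p v z = step_mean p ?u (z - x)" for z
    using step_mean_translate[of p ?u "- x" z] by (simp add: v_def[abs_def])
  have off: "h z = g z" if "z \<noteq> 0" "z \<noteq> x" for z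
    using that by (simp add: lin Pv g_def v_def hit_prob_harmonic)
  have uv: "?u (- x) = \<rho>" by (simp add: \<rho>_def hit_prob_uminus)
  have at0: "g 0 = 1 + \<alpha> + \<beta> * \<rho>" "h 0 = 1 + \<alpha> * q + \<beta> * \<rho>"
    using x uv by (simp_all add: lin Pv g_def v_def hit_prob_harmonic q_def return_prob_def)
  have atx: "g x = 1 + \<alpha> * \<rho> + \<beta>" "h x = 1 + \<alpha> * \<rho> + \<beta> * q"
    using x by (simp_all add: lin Pv g_def v_def hit_prob_harmonic q_def return_prob_def \<rho>_def)
  have pos: "0 < g z" "0 < h z" for z using g1[of z] h1[of z] by auto
  have eq: "exp (two_site_reward \<sigma> \<tau> x z) * h z = g z" for z
  proof -
    consider "z = 0" | "z = x" "x \<noteq> 0" | "z \<noteq> 0" "z \<noteq> x" using x by blast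
    then show ?thesis
    proof cases
      case 1
      have "exp \<sigma> = g 0 / h 0" unfolding \<sigma>_def at0[symmetric] using pos by simp
      then show ?thesis using 1 x pos(2)[of 0] by (simp add: two_site_reward_def)
    next
      case 2
      have "exp \<tau> = g x / h x" unfolding \<tau>_def atx[symmetric] using pos by simp
      then show ?thesis using 2 pos(2)[of x] by (simp add: two_site_reward_def)
    next
      case 3
      then show ?thesis using off by (simp add: two_site_reward_def)
    qed
  qed
  show ?thesis
  proof (rule that[of h B])
    show "step_mean p (\<lambda>z. exp (two_site_reward \<sigma> \<tau> x z) * h z) z \<le> h z" for z
      unfolding eq by (simp add: h_def)
    show "exp (two_site_reward \<sigma> \<tau> x z) * h z \<le> B" for z
      unfolding eq by (rule gB)
  qed (rule h1)
qed

text \<open>The expression equals \<open>1\<close> in the limit of no tilt towards the second site, and has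
derivative \<open>\<eta>(1-q)/\<rho>\<close> in the ratio \<open>b = \<beta>/\<alpha>\<close>; exactly the value \<open>\<rho>^2/q\<close> makes the
remaining terms cancel. A small \<open>b\<close> of the sign of \<open>\<eta>\<close> thus beats \<open>1\<close>, and by
continuity so does a large finite \<open>\<alpha>\<close>. The bound on \<open>2\<beta>\<close> ensures \<open>\<sigma> > 0\<close>.\<close>

lemma tilt_parameters_deviation:
  fixes q \<rho> \<eta> :: real
  assumes q: "0 < q" "q < 1" and \<rho>: "0 < \<rho>" "\<rho> \<le> 1" and \<eta>: "\<eta> \<noteq> 0"
  defines "\<Lambda> \<equiv> - 1 / ln q"
  shows "\<exists>\<alpha> \<beta>. 0 < \<alpha> \<and> - (\<alpha> * \<rho>) \<le> \<beta> \<and> - (\<alpha> * q) \<le> 2 * \<beta> \<and> sgn \<beta> = sgn \<eta> \<and>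
     1 < \<Lambda> * ln ((1 + \<alpha> + \<beta> * \<rho>) / (1 + \<alpha> * q + \<beta> * \<rho>)) +
         (\<Lambda> * (\<rho>\<^sup>2 / q) + \<eta>) * ln ((1 + \<alpha> * \<rho> + \<beta>) / (1 + \<alpha> * \<rho> + \<beta> * q))"
proof -
  define K where "K = \<Lambda> * (\<rho>\<^sup>2 / q) + \<eta>"
  define F where "F b = \<Lambda> * (ln (1 + b * \<rho>) - ln (q + b * \<rho>)) + K * (ln (\<rho> + b) - ln (\<rho> + b * q))" for b
  have F0: "F 0 = 1" using q by (simp add: F_def \<Lambda>_def)
  have dF: "(F has_real_derivative \<eta> * (1 - q) / \<rho>) (at 0)"
  proof -
    have "(F has_real_derivative
        \<Lambda> * (\<rho> / (1 + 0 * \<rho>) - \<rho> / (q + 0 * \<rho>)) + K * (1 / (\<rho> + 0) - q / (\<rho> + 0 * q))) (at 0)"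
      unfolding F_def by (rule derivative_eq_intros refl | use q \<rho> in simp)+
    also have "\<Lambda> * (\<rho> / (1 + 0 * \<rho>) - \<rho> / (q + 0 * \<rho>)) + K * (1 / (\<rho> + 0) - q / (\<rho> + 0 * q))
        = \<eta> * (1 - q) / \<rho>"
      using q \<rho> by (simp add: K_def field_simps power2_eq_square)
    finally show ?thesis .
  qed
  have "\<exists>b. \<bar>b\<bar> \<le> q / 2 \<and> \<bar>b\<bar> \<le> \<rho> / 2 \<and> sgn b = sgn \<eta> \<and> 1 < F b"
  proof (cases "\<eta> > 0")
    case True
    then have "0 < \<eta> * (1 - q) / \<rho>" using q \<rho> by simp
    from DERIV_pos_inc_right[OF dF this] obtain d where
      d: "d > 0" "\<And>h. 0 < h \<Longrightarrow> h < d \<Longrightarrow> F 0 < F (0 + h)" by blast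
    define b where "b = min d (min q \<rho>) / 2"
    have "0 < b" "b < d" using d(1) q \<rho> by (auto simp: b_def)
    then have "1 < F b" using d(2)[of b] F0 by simp
    moreover have "\<bar>b\<bar> \<le> q / 2" "\<bar>b\<bar> \<le> \<rho> / 2" using d(1) q \<rho> by (auto simp: b_def)
    ultimately show ?thesis using True \<open>0 < b\<close> by (intro exI[of _ b]) auto
  next
    case False
    then have "\<eta> * (1 - q) / \<rho> < 0" using q \<rho> \<eta> by (auto simp: divide_less_0_iff mult_less_0_iff)
    from DERIV_neg_dec_left[OF dF this] obtain d where
      d: "d > 0" "\<And>h. 0 < h \<Longrightarrow> h < d \<Longrightarrow> F 0 < F (0 - h)" by blast
    define b where "b = min d (min q \<rho>) / 2"
    have "0 < b" "b < d" using d(1) q \<rho> by (auto simp: b_def)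
    then have "1 < F (- b)" using d(2)[of b] F0 by simp
    moreover have "\<bar>b\<bar> \<le> q / 2" "\<bar>b\<bar> \<le> \<rho> / 2" using d(1) q \<rho> by (auto simp: b_def)
    ultimately show ?thesis using False \<eta> \<open>0 < b\<close> by (intro exI[of _ "- b"]) auto
  qed
  then obtain b where b: "\<bar>b\<bar> \<le> q / 2" "\<bar>b\<bar> \<le> \<rho> / 2" "sgn b = sgn \<eta>" "1 < F b" by blast
  have "\<bar>b * \<rho>\<bar> \<le> q / 2" using b(1) \<rho> mult_mono[of "\<bar>b\<bar>" "q / 2" \<rho> 1] q by (simp add: abs_mult)
  moreover have "\<bar>b * q\<bar> \<le> \<rho> / 2" using b(2) \<rho> mult_mono[of "\<bar>b\<bar>" "\<rho> / 2" q 1] q by (simp add: abs_mult)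
  ultimately have pos: "0 < 1 + b * \<rho>" "0 < q + b * \<rho>" "0 < \<rho> + b" "0 < \<rho> + b * q"
    using q \<rho> b by (auto simp: abs_le_iff)
  \<comment> \<open>Here \<open>k\<close> stands for \<open>1 / \<alpha>\<close>, so that the limit of infinite \<open>\<alpha>\<close> is \<open>k = 0\<close>.\<close>
  define H where "H k = \<Lambda> * (ln (k + 1 + b * \<rho>) - ln (k + q + b * \<rho>)) +
      K * (ln (k + \<rho> + b) - ln (k + \<rho> + b * q))" for k
  have "isCont H 0" unfolding H_def using pos by (intro continuous_intros) auto
  then have "(H \<longlongrightarrow> H 0) (at_right 0)"
    by (meson isCont_def tendsto_within_subset subset_UNIV)
  moreover have "H 0 = F b" by (simp add: H_def F_def)
  ultimately have "eventually (\<lambda>k. 1 < H k) (at_right 0)"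
    using b(4) by (intro order_tendstoD(1)) auto
  then obtain k where k: "k > 0" "1 < H k"
    by (metis eventually_at_right_field dense)
  define \<alpha> where "\<alpha> = 1 / k"
  have scale: "(1 + \<alpha> * r + b * \<alpha> * s) = (k + r + b * s) / k" for r s
    using k by (simp add: \<alpha>_def field_simps)
  have e1: "(1 + \<alpha> + b * \<alpha> * \<rho>) / (1 + \<alpha> * q + b * \<alpha> * \<rho>) = (k + 1 + b * \<rho>) / (k + q + b * \<rho>)"
    using scale[of 1 \<rho>] scale[of q \<rho>] k by simp
  have e2: "(1 + \<alpha> * \<rho> + b * \<alpha>) / (1 + \<alpha> * \<rho> + b * \<alpha> * q) = (k + \<rho> + b) / (k + \<rho> + b * q)"
    using scale[of \<rho> 1] scale[of \<rho> q] k by simp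
  have "1 < \<Lambda> * ln ((1 + \<alpha> + b * \<alpha> * \<rho>) / (1 + \<alpha> * q + b * \<alpha> * \<rho>)) +
         K * ln ((1 + \<alpha> * \<rho> + b * \<alpha>) / (1 + \<alpha> * \<rho> + b * \<alpha> * q))"
    unfolding e1 e2 using k pos by (simp add: H_def ln_div add.assoc)
  moreover have "sgn (b * \<alpha>) = sgn \<eta>" using b(3) k by (simp add: sgn_mult \<alpha>_def)
  moreover have "- (\<alpha> * \<rho>) \<le> b * \<alpha>" "- (\<alpha> * q) \<le> 2 * (b * \<alpha>)"
    using b(1,2) k \<rho> by (auto simp: \<alpha>_def abs_le_iff field_simps)
  moreover have "0 < \<alpha>" using k by (simp add: \<alpha>_def)
  ultimately show ?thesis unfolding K_def by blast
qed

text \<open>A tilt at one site only controls the number of visits to a single point: for infinite \<open>\<alpha>\<close> the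
logarithm is \<open>1/\<lambda>\<close>, and \<open>(\<lambda> + \<eta>)/\<lambda> > 1\<close>.\<close>

lemma tilt_parameters_single:
  fixes q \<eta> :: real
  assumes q: "0 < q" "q < 1" and \<eta>: "0 < \<eta>"
  defines "\<Lambda> \<equiv> - 1 / ln q"
  shows "\<exists>\<alpha>>0. 1 < (\<Lambda> + \<eta>) * ln ((1 + \<alpha>) / (1 + \<alpha> * q))"
proof -
  \<comment> \<open>Again \<open>k\<close> stands for \<open>1 / \<alpha>\<close>.\<close>
  define H where "H k = (\<Lambda> + \<eta>) * (ln (k + 1) - ln (k + q))" for k
  have lnq: "ln q < 0" using q by simp
  have "isCont H 0" unfolding H_def using q by (intro continuous_intros) auto
  then have "(H \<longlongrightarrow> H 0) (at_right 0)"
    by (meson isCont_def tendsto_within_subset subset_UNIV)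
  moreover have "H 0 = 1 + \<eta> * (- ln q)" using lnq by (simp add: H_def \<Lambda>_def field_simps)
  then have "1 < H 0" using lnq \<eta> by (simp add: mult_pos_neg)
  ultimately have "eventually (\<lambda>k. 1 < H k) (at_right 0)"
    by (intro order_tendstoD(1)) auto
  then obtain k where k: "k > 0" "1 < H k"
    by (metis eventually_at_right_field dense)
  have "(1 + 1 / k) / (1 + 1 / k * q) = (k + 1) / (k + q)"
  proof -
    have "1 + 1 / k = (k + 1) / k" "1 + 1 / k * q = (k + q) / k"
      using k by (simp_all add: field_simps)
    then show ?thesis using k by (simp only:) simp
  qed
  then have "1 < (\<Lambda> + \<eta>) * ln ((1 + 1 / k) / (1 + 1 / k * q))"
    using k q by (simp add: H_def ln_div)
  then show ?thesis using k by (intro exI[of _ "1 / k"]) auto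
qed

section \<open>Transfer to the random walk\<close>

lemma pmf_replicate_pmf:
  "pmf (replicate_pmf (length xs) p) xs = (\<Prod>i<length xs. pmf p (xs ! i))"
proof (induction xs)
  case (Cons y ys)
  have "pmf (replicate_pmf (length (y # ys)) p) (y # ys) =
      measure (replicate_pmf (Suc (length ys)) p) {y # ys}"
    by (simp only: measure_pmf_single list.size add_Suc_right add_0_right)
  also have "\<dots> = measure_pmf.expectation p
      (\<lambda>x. of_bool (x = y) * pmf (replicate_pmf (length ys) p) ys)"
    unfolding measure_replicate_pmf_Suc
  proof (rule Bochner_Integration.integral_cong[OF refl])
    fix x
    have "{xs. x # xs \<in> {y # ys}} = (if x = y then {ys} else {})" by auto
    then show "measure (replicate_pmf (length ys) p) {xs. x # xs \<in> {y # ys}} =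
        of_bool (x = y) * pmf (replicate_pmf (length ys) p) ys"
      by (simp add: measure_pmf_single)
  qed
  also have "\<dots> = pmf p y * pmf (replicate_pmf (length ys) p) ys"
    by (subst integral_measure_pmf_real[of "{y}"]) auto
  also have "\<dots> = (\<Prod>i<Suc (length ys). pmf p ((y # ys) ! i))"
    by (subst prod.lessThan_Suc_shift) (simp add: Cons)
  finally show ?case by simp
qed simp

lemma hit_within_eq_measure:
  "hit_within p n y = measure (replicate_pmf n p) {xs. \<exists>m\<le>n. y + sum_list (take m xs) = 0}"
proof (induction n arbitrary: y)
  case 0
  then show ?case by (auto simp: indicator_def)
next
  case (Suc n)
  show ?case
  proof (cases "y = 0")
    case True
    then have "{xs. \<exists>m\<le>Suc n. y + sum_list (take m xs) = 0} = UNIV"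
      by (auto intro: exI[of _ 0])
    then show ?thesis using True by simp
  next
    case False
    have "x # xs \<in> {xs. \<exists>m\<le>Suc n. y + sum_list (take m xs) = 0} \<longleftrightarrow>
        (\<exists>m\<le>n. y + x + sum_list (take m xs) = 0)" for x xs
    proof
      assume "x # xs \<in> {xs. \<exists>m\<le>Suc n. y + sum_list (take m xs) = 0}"
      then obtain m where m: "m \<le> Suc n" "y + sum_list (take m (x # xs)) = 0" by blast
      then obtain k where "m = Suc k" using False by (cases m) auto
      then show "\<exists>m\<le>n. y + x + sum_list (take m xs) = 0"
        using m by (intro exI[of _ k]) (auto simp: add.assoc)
    next
      assume "\<exists>m\<le>n. y + x + sum_list (take m xs) = 0"
      then obtain m where "m \<le> n" "y + x + sum_list (take m xs) = 0" by blast
      then show "x # xs \<in> {xs. \<exists>m\<le>Suc n. y + sum_list (take m xs) = 0}"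
        by (auto intro!: exI[of _ "Suc m"] simp: add.assoc)
    qed
    then show ?thesis
      using False Suc unfolding measure_replicate_pmf_Suc by (simp add: step_mean_def)
  qed
qed

context iid_steps
begin

definition steps_after :: "nat \<Rightarrow> nat \<Rightarrow> 'w \<Rightarrow> (int ^ 'd) list" where
  "steps_after j n \<omega> = map (\<lambda>i. X (Suc (j + i)) \<omega>) [0..<n]"

lemma X_measurable: "k \<ge> 1 \<Longrightarrow> X k \<in> measurable M (count_space UNIV)"
  using indep_steps by (auto simp: indep_vars_def)

lemma steps_after_measurable [measurable]:
  "steps_after j n \<in> measurable M (count_space UNIV)"
proof (induction n)
  case 0
  then show ?case by (simp add: steps_after_def)
next
  case (Suc n)
  have X: "X (Suc (j + n)) \<in> measurable M (count_space UNIV)" by (rule X_measurable) simp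
  have "(\<lambda>\<omega>. steps_after j n \<omega> @ [X (Suc (j + n)) \<omega>]) \<in> measurable M (count_space UNIV)"
  proof (rule measurable_compose_countable[OF _ X])
    fix x
    show "(\<lambda>\<omega>. steps_after j n \<omega> @ [x]) \<in> measurable M (count_space UNIV)"
      by (rule measurable_compose[OF Suc]) simp
  qed
  then show ?case by (simp add: steps_after_def)
qed

lemma distr_steps_after:
  "distr M (count_space UNIV) (steps_after j n) = measure_pmf (replicate_pmf n p)"
proof (rule measure_eqI_countable[where A=UNIV])
  fix xs :: "(int ^ 'd) list"
  have "emeasure (distr M (count_space UNIV) (steps_after j n)) {xs} =
      prob {\<omega> \<in> space M. steps_after j n \<omega> = xs}"
    by (subst emeasure_distr) (auto simp: emeasure_eq_measure vimage_def intro!: arg_cong[where f=prob])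
  also have "\<dots> = pmf (replicate_pmf n p) xs"
  proof (cases "length xs = n")
    case True
    show ?thesis
    proof (cases "n = 0")
      case True
      then show ?thesis using \<open>length xs = n\<close> by (simp add: steps_after_def prob_space)
    next
      case False
      have eq: "{\<omega> \<in> space M. steps_after j n \<omega> = xs} =
          (\<Inter>k\<in>{Suc j..j + n}. X k -` {xs ! (k - Suc j)} \<inter> space M)" (is "?L = ?R")
      proof
        show "?L \<subseteq> ?R" by (auto simp: steps_after_def)
        show "?R \<subseteq> ?L"
        proof
          fix \<omega> assume \<omega>: "\<omega> \<in> ?R"
          have "\<omega> \<in> space M" using \<omega> False by (auto dest!: bspec[of _ _ "Suc j"])
          moreover have "X (Suc (j + i)) \<omega> = xs ! i" if "i < n" for i
            using \<omega> that by (auto dest!: bspec[of _ _ "Suc (j + i)"])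
          ultimately show "\<omega> \<in> ?L"
            using \<open>length xs = n\<close> by (auto simp: steps_after_def intro!: nth_equalityI)
        qed
      qed
      have "prob ?R = (\<Prod>k\<in>{Suc j..j + n}. prob (X k -` {xs ! (k - Suc j)} \<inter> space M))"
        by (rule indep_varsD[OF indep_steps]) (use False in auto)
      also have "\<dots> = (\<Prod>k\<in>{Suc j..j + n}. pmf p (xs ! (k - Suc j)))"
      proof (rule prod.cong[OF refl])
        fix k assume "k \<in> {Suc j..j + n}"
        then have k: "k \<ge> 1" by auto
        have "prob (X k -` {z} \<inter> space M) = pmf p z" for z
          using measure_distr[OF X_measurable[OF k], of "{z}"] distr_steps[OF k]
          by (simp add: measure_pmf_single)
        then show "prob (X k -` {xs ! (k - Suc j)} \<inter> space M) = pmf p (xs ! (k - Suc j))" .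
      qed
      also have "\<dots> = (\<Prod>i<n. pmf p (xs ! i))"
        by (rule prod.reindex_bij_witness[of _ "\<lambda>i. Suc (j + i)" "\<lambda>k. k - Suc j"]) auto
      finally show ?thesis using eq \<open>length xs = n\<close> pmf_replicate_pmf[of xs p] by simp
    qed
  next
    case False
    then have "{\<omega> \<in> space M. steps_after j n \<omega> = xs} = {}" by (auto simp: steps_after_def)
    then have "prob {\<omega> \<in> space M. steps_after j n \<omega> = xs} = 0" by (simp only: measure_empty)
    moreover have "pmf (replicate_pmf n p) xs = 0"
      using False by (simp add: pmf_eq_0_set_pmf set_replicate_pmf)
    ultimately show ?thesis by simp
  qed
  also have "\<dots> = emeasure (replicate_pmf n p) {xs}" by (simp add: emeasure_pmf_single)
  finally show "emeasure (distr M (count_space UNIV) (steps_after j n)) {xs} =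
      emeasure (replicate_pmf n p) {xs}" .
qed auto

lemma prob_steps_after:
  "prob {\<omega> \<in> space M. Q (steps_after j n \<omega>)} = measure (replicate_pmf n p) {xs. Q xs}"
proof -
  have "measure (replicate_pmf n p) {xs. Q xs} =
      measure (distr M (count_space UNIV) (steps_after j n)) {xs. Q xs}"
    by (simp add: distr_steps_after)
  also have "\<dots> = prob {\<omega> \<in> space M. Q (steps_after j n \<omega>)}"
    by (subst measure_distr[OF steps_after_measurable]) (auto intro!: arg_cong[where f=prob])
  finally show ?thesis ..
qed

lemma sets_steps_after: "{\<omega> \<in> space M. Q (steps_after j n \<omega>)} \<in> sets M"
proof -
  have "steps_after j n -` {xs. Q xs} \<inter> space M \<in> sets M" by (rule measurable_sets[OF steps_after_measurable]) simp
  also have "steps_after j n -` {xs. Q xs} \<inter> space M = {\<omega> \<in> space M. Q (steps_after j n \<omega>)}" by auto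
  finally show ?thesis .
qed

lemma sum_take_steps_after:
  assumes "m \<le> n"
  shows "sum_list (take m (steps_after j n \<omega>)) = walk X (j + m) \<omega> - walk X j \<omega>"
  using assms
proof (induction m)
  case (Suc m)
  then have "take (Suc m) (steps_after j n \<omega>) = take m (steps_after j n \<omega>) @ [X (Suc (j + m)) \<omega>]"
    by (subst take_Suc_conv_app_nth) (auto simp: steps_after_def)
  then show ?case using Suc by (simp add: walk_def)
qed simp

lemma walk_eq_sum_list: "walk X n \<omega> = sum_list (steps_after 0 n \<omega>)"
  using sum_take_steps_after[of n n 0 \<omega>] by (simp add: steps_after_def walk_def)

lemma reachable_sum_list:
  assumes "x \<in> reachable M X"
  shows "\<exists>xs. set xs \<subseteq> set_pmf p \<and> sum_list xs = x"
proof -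
  obtain n where "0 < prob {\<omega> \<in> space M. walk X n \<omega> = x}" using assms by (auto simp: reachable_def)
  then have "measure (replicate_pmf n p) {xs. sum_list xs = x} \<noteq> 0"
    using prob_steps_after[of "\<lambda>xs. sum_list xs = x" 0 n] by (simp add: walk_eq_sum_list)
  then obtain xs where "xs \<in> set_pmf (replicate_pmf n p)" "sum_list xs = x"
    by (auto simp: measure_pmf_zero_iff)
  then show ?thesis by (auto simp: set_replicate_pmf)
qed

lemma generating_of_aperiodic:
  assumes "symmetric_step p" "aperiodic_walk M X"
  shows "symmetric_generating_step p"
proof
  show sym: "pmf p (- x) = pmf p x" for x using assms(1) by (simp add: symmetric_step_def)
  fix x
  obtain y z where yz: "y \<in> reachable M X" "z \<in> reachable M X" "x = y - z"
    using assms(2) unfolding aperiodic_walk_def by blast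
  obtain ys zs where s: "set ys \<subseteq> set_pmf p" "sum_list ys = y" "set zs \<subseteq> set_pmf p" "sum_list zs = z"
    using reachable_sum_list yz by metis
  have "sum_list (map uminus zs) = - sum_list zs" for zs :: "(int ^ 'd) list"
    by (induction zs) auto
  moreover have "set (map uminus zs) \<subseteq> set_pmf p"
    using s(3) sym by (auto simp: set_pmf_eq subset_iff)
  ultimately show "\<exists>xs. set xs \<subseteq> set_pmf p \<and> sum_list xs = x"
    using s yz by (intro exI[of _ "ys @ map uminus zs"]) auto
qed

text \<open>Averaging over the first step turns hitting \<open>x\<close> at a positive time into hitting at any time.\<close>

lemma escape_prob_eq: "escape_prob M X x = 1 - step_mean p (hit_prob p) (- x)"
proof -
  define E where "E n = {\<omega> \<in> space M. \<exists>m\<le>n. walk X (Suc m) \<omega> = x}" for n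
  have E_eq: "E n = {\<omega> \<in> space M. \<exists>m\<le>n. sum_list (take (Suc m) (steps_after 0 (Suc n) \<omega>)) = x}" for n
    by (auto simp: E_def sum_take_steps_after walk_def)
  have sets: "E n \<in> sets M" for n unfolding E_eq by (rule sets_steps_after)
  have "prob (E n) = step_mean p (hit_within p n) (- x)" for n
  proof -
    have "prob (E n) = measure (replicate_pmf (Suc n) p) {xs. \<exists>m\<le>n. sum_list (take (Suc m) xs) = x}"
      unfolding E_eq by (rule prob_steps_after)
    also have "\<dots> = step_mean p (hit_within p n) (- x)"
      unfolding measure_replicate_pmf_Suc step_mean_def hit_within_eq_measure
      by (intro Bochner_Integration.integral_cong refl arg_cong2[where f=measure])
         (auto simp: eq_neg_iff_add_eq_0 algebra_simps)
    finally show ?thesis .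
  qed
  moreover have "(\<lambda>n. prob (E n)) \<longlonglongrightarrow> prob (\<Union>n. E n)"
  proof (rule finite_Lim_measure_incseq)
    show "incseq E" unfolding incseq_def E_def using le_trans by blast
  qed (use sets in auto)
  ultimately have "prob (\<Union>n. E n) = step_mean p (hit_prob p) (- x)"
    by (intro LIMSEQ_unique[OF _ step_mean_hit_within_LIMSEQ]) simp
  moreover have "{\<omega> \<in> space M. \<forall>i\<ge>1. walk X i \<omega> \<noteq> x} = space M - (\<Union>n. E n)"
  proof -
    have "(\<exists>i\<ge>1. walk X i \<omega> = x) \<longleftrightarrow> (\<exists>n. \<exists>m\<le>n. walk X (Suc m) \<omega> = x)" for \<omega>
    proof
      assume "\<exists>i\<ge>1. walk X i \<omega> = x"
      then obtain i where "1 \<le> i" "walk X i \<omega> = x" by blast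
      then show "\<exists>n. \<exists>m\<le>n. walk X (Suc m) \<omega> = x"
        by (intro exI[of _ "i - 1"]) auto
    next
      assume "\<exists>n. \<exists>m\<le>n. walk X (Suc m) \<omega> = x"
      then obtain m where "walk X (Suc m) \<omega> = x" by blast
      then show "\<exists>i\<ge>1. walk X i \<omega> = x" by (intro exI[of _ "Suc m"]) auto
    qed
    then show ?thesis by (auto simp: E_def)
  qed
  ultimately show ?thesis
    unfolding escape_prob_def using prob_compl[of "\<Union>n. E n"] sets by auto
qed

text \<open>The steps after time \<open>j\<close> have the same law as the original ones, so the maximal inequality applies. Its
bound does not depend on the horizon and therefore survives the limit to an infinite one.\<close>

lemma prob_exceed:
  fixes f h :: "int ^ 'd \<Rightarrow> real" and y :: "int ^ 'd" and j :: nat and l :: real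
  assumes h: "\<And>z. 1 \<le> h z"
    and super: "\<And>z. step_mean p (\<lambda>z. exp (f z) * h z) z \<le> h z"
    and bdd: "\<And>z. exp (f z) * h z \<le> B"
  defines "E \<equiv> {\<omega> \<in> space M. \<exists>m. l \<le> (\<Sum>i<m. f (y + (walk X (j + Suc i) \<omega> - walk X j \<omega>)))}"
  shows "E \<in> sets M" "prob E \<le> h y * exp (- l)"
proof -
  define F where "F n = {\<omega> \<in> space M. \<exists>m\<le>n. l \<le> (\<Sum>i<m. f (y + (walk X (j + Suc i) \<omega> - walk X j \<omega>)))}" for n
  have F_eq: "F n = {\<omega> \<in> space M. \<exists>m\<le>n. l \<le> (\<Sum>i<m. f (y + sum_list (take (Suc i) (steps_after j n \<omega>))))}" for n
  proof -
    have "(\<Sum>i<m. f (y + sum_list (take (Suc i) (steps_after j n \<omega>)))) =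
        (\<Sum>i<m. f (y + (walk X (j + Suc i) \<omega> - walk X j \<omega>)))" if "m \<le> n" for m \<omega>
      using that by (intro sum.cong refl) (auto simp: sum_take_steps_after)
    then show ?thesis unfolding F_def by (intro Collect_cong conj_cong refl ex_cong1) auto
  qed
  have sets: "F n \<in> sets M" for n unfolding F_eq by (rule sets_steps_after)
  have E: "E = (\<Union>n. F n)" unfolding E_def F_def by auto
  show "E \<in> sets M" unfolding E using sets by auto
  have "(\<lambda>n. prob (F n)) \<longlonglongrightarrow> prob (\<Union>n. F n)"
  proof (rule finite_Lim_measure_incseq)
    show "incseq F" unfolding incseq_def F_def using le_trans by blast
  qed (use sets in auto)
  moreover have "prob (F n) \<le> h y * exp (- l)" for n
  proof -
    have "prob (F n) = measure (replicate_pmf n p)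
        {xs. \<exists>m\<le>n. l \<le> (\<Sum>i<m. f (y + sum_list (take (Suc i) xs)))}"
      unfolding F_eq by (rule prob_steps_after)
    then show ?thesis using ville_inequality[OF h super bdd, of n l y] by simp
  qed
  ultimately show "prob E \<le> h y * exp (- l)"
    unfolding E by (intro LIMSEQ_le_const2) auto
qed

end

section \<open>Almost sure uniform local time asymptotics\<close>

context iid_steps
begin

text \<open>At level \<open>c k log 2\<close> a single starting time fails with probability of order \<open>2^(-ck)\<close>, so all
\<open>2^(k+1) + 1\<close> starting times together fail with probability of order \<open>2^((1-c)k)\<close>, which is summable.
Every \<open>n\<close> between \<open>2^k\<close> and \<open>2^(k+1)\<close> has \<open>log n \<ge> k log 2\<close> and only uses these starting times.\<close>

lemma AE_rewards_less_log:
  fixes f h :: "int ^ 'd \<Rightarrow> real" and y :: "int ^ 'd" and c :: real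
  assumes h: "\<And>z. 1 \<le> h z"
    and super: "\<And>z. step_mean p (\<lambda>z. exp (f z) * h z) z \<le> h z"
    and bdd: "\<And>z. exp (f z) * h z \<le> B"
    and c: "1 < c"
  shows "AE \<omega> in M. eventually (\<lambda>n. \<forall>j\<le>n. \<forall>m.
      (\<Sum>i<m. f (y + (walk X (j + Suc i) \<omega> - walk X j \<omega>))) < c * ln (real n)) sequentially"
proof -
  define l where "l k = c * (real k * ln 2)" for k
  define E where "E j k = {\<omega> \<in> space M. \<exists>m. l k \<le> (\<Sum>i<m. f (y + (walk X (j + Suc i) \<omega> - walk X j \<omega>)))}" for j k
  define F where "F k = (\<Union>j\<le>2 ^ Suc k. E j k)" for k
  have E: "E j k \<in> sets M" "prob (E j k) \<le> h y * exp (- l k)" for j k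
    unfolding E_def by (rule prob_exceed[OF h super bdd])+
  have F: "F k \<in> sets M" for k using E by (auto simp: F_def)
  have F_le: "prob (F k) \<le> 3 * h y * (2 * exp (- (c * ln 2))) ^ k" for k
  proof -
    have "prob (F k) \<le> (\<Sum>j\<le>2 ^ Suc k. prob (E j k))"
      unfolding F_def by (rule finite_measure_subadditive_finite) (use E in auto)
    also have "\<dots> \<le> (\<Sum>j\<le>(2::nat) ^ Suc k. h y * exp (- l k))" by (intro sum_mono E)
    also have "\<dots> = (2 * 2 ^ k + 1) * (h y * exp (- l k))" by simp
    also have "\<dots> \<le> (3 * 2 ^ k) * (h y * exp (- l k))"
      using h[of y] by (intro mult_right_mono) auto
    also have "exp (- l k) = exp (- (c * ln 2)) ^ k"
      by (simp add: l_def flip: exp_of_nat_mult)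
    finally show ?thesis by (simp add: power_mult_distrib mult_ac)
  qed
  have "2 * exp (- (c * ln 2)) < 1"
  proof -
    have "2 * exp (- (c * ln 2)) = exp ((1 - c) * ln 2)"
      by (simp add: left_diff_distrib exp_diff exp_minus field_simps)
    also have "\<dots> < 1" using c by (simp add: mult_neg_pos)
    finally show ?thesis .
  qed
  then have "summable (\<lambda>k. 3 * h y * (2 * exp (- (c * ln 2))) ^ k)"
    by (intro summable_mult summable_geometric) simp
  then have "summable (\<lambda>k. prob (F k))"
    by (rule summable_comparison_test'[where N=0]) (use F_le in simp)
  then have "AE \<omega> in M. eventually (\<lambda>k. \<omega> \<in> space M - F k) sequentially"
    by (intro borel_cantelli_AE1) (use F in \<open>auto simp: emeasure_eq_measure\<close>)
  then show ?thesis
    using AE_space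
  proof eventually_elim
    case (elim \<omega>)
    then have \<omega>: "\<omega> \<in> space M" by simp
    obtain K where K: "\<And>k. k \<ge> K \<Longrightarrow> \<omega> \<notin> F k" using elim by (auto simp: eventually_sequentially)
    show ?case
      unfolding eventually_sequentially
    proof (intro exI allI impI)
      fix n j m :: nat
      assume n: "2 ^ Suc K \<le> n" and j: "j \<le> n"
      have n1: "1 \<le> n" using n order_trans[of 1 "2 ^ Suc K" n] by simp
      obtain k where k: "2 ^ k \<le> n" "n < 2 ^ Suc k"
        using ex_power_ivl1[of 2 n] n1 by auto
      have "(2::nat) ^ Suc K < 2 ^ Suc k" using n k by linarith
      then have "K \<le> k" by simp
      then have "\<omega> \<notin> E j k" using K[of k] j k by (auto simp: F_def)
      then have "(\<Sum>i<m. f (y + (walk X (j + Suc i) \<omega> - walk X j \<omega>))) < l k"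
        using \<omega> by (auto simp: E_def not_le)
      also have "real k * ln 2 \<le> ln (real n)"
      proof -
        have "real k * ln 2 = ln (2 ^ k)" by (simp add: ln_realpow)
        also have "\<dots> \<le> ln (real n)"
        proof (rule ln_mono)
          show "(2::real) ^ k \<le> real n" using k(1) by (metis of_nat_le_iff of_nat_numeral of_nat_power)
        qed (use n1 in auto)
        finally show ?thesis .
      qed
      then have "l k \<le> c * ln (real n)" using c by (simp add: l_def)
      finally show "(\<Sum>i<m. f (y + (walk X (j + Suc i) \<omega> - walk X j \<omega>))) < c * ln (real n)" .
    qed
  qed
qed

end

text \<open>Counting from time \<open>j\<close> loses the visits before \<open>j\<close>. If \<open>j\<close> is the first visit to
\<open>{z, x + z}\<close>, nothing is lost except time \<open>j\<close> itself, which accounts for the additive constant. That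
first visit may happen at either site, so the hypothesis is required for both relative
positions.\<close>

lemma local_time_le_of_rewards:
  fixes X :: "nat \<Rightarrow> 'w \<Rightarrow> int ^ 'd"
  assumes x: "x \<noteq> 0"
    and bound: "\<And>y j m. y \<in> {0, x} \<Longrightarrow> j \<le> n \<Longrightarrow>
      (\<Sum>i<m. two_site_reward \<sigma> \<tau> x (y + (walk X (j + Suc i) \<omega> - walk X j \<omega>))) < L"
    and j0: "j0 \<le> n"
  defines "z \<equiv> walk X j0 \<omega>"
  shows "\<sigma> * local_time X z m \<omega> + \<tau> * local_time X (x + z) m \<omega> \<le> L + \<bar>\<sigma>\<bar> + \<bar>\<tau>\<bar>"
proof -
  define G where "G k = two_site_reward \<sigma> \<tau> x (walk X k \<omega> - z)" for k
  define j where "j = (LEAST j. walk X j \<omega> \<in> {z, x + z})"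
  have "walk X j0 \<omega> \<in> {z, x + z}" by (simp add: z_def)
  then have j: "walk X j \<omega> \<in> {z, x + z}" "j \<le> j0"
    unfolding j_def by (rule LeastI, rule Least_le)
  have before: "G k = 0" if "k < j" for k
  proof -
    have "walk X k \<omega> \<notin> {z, x + z}" using not_less_Least[of k] that unfolding j_def by blast
    then show ?thesis by (auto simp: G_def two_site_reward_def algebra_simps)
  qed
  have at: "\<bar>G k\<bar> \<le> \<bar>\<sigma>\<bar> + \<bar>\<tau>\<bar>" for k
    by (auto simp: G_def two_site_reward_def)
  define y where "y = walk X j \<omega> - z"
  have y: "y \<in> {0, x}" using j by (auto simp: y_def)
  have after: "(\<Sum>i<k. G (j + Suc i)) < L" for k
  proof -
    have "(\<Sum>i<k. G (j + Suc i)) =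
        (\<Sum>i<k. two_site_reward \<sigma> \<tau> x (y + (walk X (j + Suc i) \<omega> - walk X j \<omega>)))"
      by (simp add: G_def y_def)
    also have "\<dots> < L" by (rule bound[OF y]) (use j j0 in auto)
    finally show ?thesis .
  qed
  have "\<sigma> * local_time X z m \<omega> + \<tau> * local_time X (x + z) m \<omega> = (\<Sum>k=1..m. G k)"
  proof -
    have "G k = \<sigma> * of_bool (walk X k \<omega> = z) + \<tau> * of_bool (walk X k \<omega> = x + z)" for k
      by (simp add: G_def two_site_reward_def diff_eq_eq)
    then show ?thesis by (simp add: local_time_def sum_distrib_left sum.distrib)
  qed
  also have "{1..m} = ({1..m} \<inter> {..j}) \<union> {j<..m}" by auto
  also have "(\<Sum>k\<in>({1..m} \<inter> {..j}) \<union> {j<..m}. G k) = (\<Sum>k\<in>{1..m} \<inter> {..j}. G k) + (\<Sum>k\<in>{j<..m}. G k)"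
    by (rule sum.union_disjoint) auto
  also have "(\<Sum>k\<in>{1..m} \<inter> {..j}. G k) \<le> \<bar>\<sigma>\<bar> + \<bar>\<tau>\<bar>"
  proof -
    have "(\<Sum>k\<in>{1..m} \<inter> {..j}. G k) = (\<Sum>k\<in>{1..m} \<inter> {j}. G k)"
    proof (rule sum.mono_neutral_right)
      show "\<forall>i\<in>{1..m} \<inter> {..j} - {1..m} \<inter> {j}. G i = 0"
      proof
        fix i assume "i \<in> {1..m} \<inter> {..j} - {1..m} \<inter> {j}"
        then have "i < j" by auto
        then show "G i = 0" by (rule before)
      qed
    qed auto
    also have "\<dots> \<le> \<bar>\<sigma>\<bar> + \<bar>\<tau>\<bar>"
      using at[of j] by (cases "j \<in> {1..m}") auto
    finally show ?thesis .
  qed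
  also have "(\<Sum>k\<in>{j<..m}. G k) = (\<Sum>i<m - j. G (j + Suc i))"
    by (rule sum.reindex_bij_witness[of _ "\<lambda>i. j + Suc i" "\<lambda>k. k - Suc j"]) auto
  also have "\<dots> \<le> L" using after[of "m - j"] by simp
  finally show ?thesis by simp
qed

locale transient_walk = iid_steps M X p + symmetric_generating_step p
  for M :: "'w measure" and X :: "nat \<Rightarrow> 'w \<Rightarrow> int ^ 'd" and p :: "(int ^ 'd) pmf" +
  assumes dim: "CARD('d) \<ge> 3"
begin

abbreviation "\<Lambda> \<equiv> walk_lambda M X"

lemma walk_lambda_eq: "\<Lambda> = - 1 / ln (return_prob p)"
  by (simp add: walk_lambda_def escape_prob_eq return_prob_def)

lemma walk_lambda_pos: "0 < \<Lambda>"
  using return_prob_pos return_prob_less_1[OF dim] by (simp add: walk_lambda_eq divide_neg_neg)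

lemma walk_m_eq: "walk_m M X x = (if x = 0 then 1 else (hit_prob p x)\<^sup>2 / return_prob p)"
  by (simp add: walk_m_def escape_prob_eq return_prob_def hit_prob_harmonic hit_prob_uminus)

lemma AE_local_times_tilted:
  fixes x :: "int ^ 'd" and \<alpha> \<beta> c :: real
  defines "q \<equiv> return_prob p" and "\<rho> \<equiv> hit_prob p x"
  defines "\<sigma> \<equiv> ln ((1 + \<alpha> + \<beta> * \<rho>) / (1 + \<alpha> * q + \<beta> * \<rho>))"
    and "\<tau> \<equiv> ln ((1 + \<alpha> * \<rho> + \<beta>) / (1 + \<alpha> * \<rho> + \<beta> * q))"
  assumes x: "x \<noteq> 0" and \<alpha>: "0 \<le> \<alpha>" and \<beta>: "- (\<alpha> * \<rho>) \<le> \<beta>" and c: "1 < c"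
  shows "AE \<omega> in M. eventually (\<lambda>n. \<forall>j\<le>n. \<forall>m. \<sigma> * local_time X (walk X j \<omega>) m \<omega> +
           \<tau> * local_time X (x + walk X j \<omega>) m \<omega> \<le> c * ln (real n)) sequentially"
proof -
  obtain h B where h: "\<And>z. 1 \<le> h z"
    "\<And>z. step_mean p (\<lambda>z. exp (two_site_reward \<sigma> \<tau> x z) * h z) z \<le> h z"
    "\<And>z. exp (two_site_reward \<sigma> \<tau> x z) * h z \<le> B"
    by (rule tilted_supermartingale[OF x \<alpha> \<beta>[unfolded \<rho>_def],
          folded q_def \<rho>_def, folded \<sigma>_def \<tau>_def]) (rule that)
  \<comment> \<open>The slack between \<open>c'\<close> and \<open>c\<close> absorbs the additive constant of the first visit.\<close>
  define c' where "c' = (1 + c) / 2"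
  have c': "1 < c'" "c' < c" using c by (auto simp: c'_def)
  have "eventually (\<lambda>n::nat. \<bar>\<sigma>\<bar> + \<bar>\<tau>\<bar> \<le> (c - c') * ln (real n)) sequentially"
  proof -
    have "filterlim (\<lambda>n::nat. (c - c') * ln (real n)) at_top sequentially"
      by (intro filterlim_tendsto_pos_mult_at_top[OF tendsto_const])
         (use c' in \<open>auto intro!: filterlim_compose[OF ln_at_top filterlim_real_sequentially]\<close>)
    then show ?thesis by (simp add: filterlim_at_top)
  qed
  note large = this
  have ae: "AE \<omega> in M. eventually (\<lambda>n. \<forall>j\<le>n. \<forall>m. (\<Sum>i<m. two_site_reward \<sigma> \<tau> x
      (y + (walk X (j + Suc i) \<omega> - walk X j \<omega>))) < c' * ln (real n)) sequentially" for y
    by (rule AE_rewards_less_log[OF h c'(1)])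
  show ?thesis
    using ae[of 0] ae[of x]
  proof eventually_elim
    case (elim \<omega>)
    then show ?case using large
    proof eventually_elim
      case (elim n)
      show ?case
      proof (intro allI impI)
        fix j m assume "j \<le> n"
        then have "\<sigma> * local_time X (walk X j \<omega>) m \<omega> + \<tau> * local_time X (x + walk X j \<omega>) m \<omega>
            \<le> c' * ln (real n) + \<bar>\<sigma>\<bar> + \<bar>\<tau>\<bar>"
          using elim by (intro local_time_le_of_rewards[OF x]) auto
        then show "\<sigma> * local_time X (walk X j \<omega>) m \<omega> + \<tau> * local_time X (x + walk X j \<omega>) m \<omega>
            \<le> c * ln (real n)"
          using elim(3) by (simp add: left_diff_distrib)
      qed
    qed
  qed
qed

lemma AE_local_time_upper:
  assumes \<eta>: "0 < \<eta>"
  shows "AE \<omega> in M. eventually (\<lambda>n. \<forall>j\<le>n. \<forall>m.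
           local_time X (walk X j \<omega>) m \<omega> \<le> (\<Lambda> + \<eta>) * ln (real n)) sequentially"
proof -
  let ?q = "return_prob p"
  have q: "0 < ?q" "?q < 1" using return_prob_pos return_prob_less_1[OF dim] .
  obtain \<alpha> where \<alpha>: "0 < \<alpha>" "1 < (\<Lambda> + \<eta>) * ln ((1 + \<alpha>) / (1 + \<alpha> * ?q))"
    using tilt_parameters_single[OF q \<eta>] unfolding walk_lambda_eq by blast
  define \<sigma> where "\<sigma> = ln ((1 + \<alpha>) / (1 + \<alpha> * ?q))"
  have K: "0 < \<Lambda> + \<eta>" using walk_lambda_pos \<eta> by simp
  have \<sigma>: "0 < \<sigma>" using \<alpha> K unfolding \<sigma>_def by (metis less_trans zero_less_mult_pos zero_less_one)
  \<comment> \<open>With \<open>\<beta> = 0\<close> the reward at the second site vanishes, so any nonzero site will do.\<close>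
  define x :: "int ^ 'd" where "x = 1"
  have x: "x \<noteq> 0" by (simp add: x_def)
  have "0 < 1 + \<alpha> * hit_prob p x" using \<alpha> hit_prob_bounds[of p x] by (simp add: add_pos_nonneg)
  then have "AE \<omega> in M. eventually (\<lambda>n. \<forall>j\<le>n. \<forall>m. \<sigma> * local_time X (walk X j \<omega>) m \<omega>
      \<le> ((\<Lambda> + \<eta>) * \<sigma>) * ln (real n)) sequentially"
    using AE_local_times_tilted[OF x, of \<alpha> 0 "(\<Lambda> + \<eta>) * \<sigma>"] \<alpha> hit_prob_bounds[of p x]
    by (simp add: \<sigma>_def)
  then show ?thesis
  proof eventually_elim
    case (elim \<omega>)
    then show ?case
    proof eventually_elim
      case (elim n)
      show ?case
      proof (intro allI impI)
        fix j m assume "j \<le> n"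
        then have "\<sigma> * local_time X (walk X j \<omega>) m \<omega> \<le> \<sigma> * ((\<Lambda> + \<eta>) * ln (real n))"
          using elim by (simp add: mult_ac)
        then show "local_time X (walk X j \<omega>) m \<omega> \<le> (\<Lambda> + \<eta>) * ln (real n)"
          using \<sigma> by simp
      qed
    qed
  qed
qed

text \<open>Positive \<open>\<eta>\<close> gives the upper bound and negative \<open>\<eta>\<close> the lower bound for the local time at
\<open>x + z\<close>: the parameter \<open>\<tau>\<close> has the sign of \<open>\<eta>\<close>, so dividing by it keeps or reverses the
inequality accordingly.\<close>

lemma AE_shifted_local_time:
  assumes x: "x \<noteq> 0" and \<eta>: "\<eta> \<noteq> 0" and \<epsilon>: "\<epsilon> \<longlonglongrightarrow> 0"
  shows "AE \<omega> in M. eventually (\<lambda>n. \<forall>j\<le>n. \<forall>m.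
           (1 - \<epsilon> n) * \<Lambda> * ln (real n) \<le> local_time X (walk X j \<omega>) m \<omega> \<longrightarrow>
           sgn \<eta> * local_time X (x + walk X j \<omega>) m \<omega> \<le>
             sgn \<eta> * ((\<Lambda> * walk_m M X x + \<eta>) * ln (real n))) sequentially"
proof -
  let ?q = "return_prob p" and ?\<rho> = "hit_prob p x" and ?K = "\<Lambda> * walk_m M X x + \<eta>"
  have q: "0 < ?q" "?q < 1" using return_prob_pos return_prob_less_1[OF dim] .
  have \<rho>: "0 < ?\<rho>" "?\<rho> \<le> 1" using hit_prob_pos hit_prob_bounds by auto
  obtain \<alpha> \<beta> where \<alpha>\<beta>: "0 < \<alpha>" "- (\<alpha> * ?\<rho>) \<le> \<beta>" "- (\<alpha> * ?q) \<le> 2 * \<beta>" "sgn \<beta> = sgn \<eta>"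
    and gt: "1 < \<Lambda> * ln ((1 + \<alpha> + \<beta> * ?\<rho>) / (1 + \<alpha> * ?q + \<beta> * ?\<rho>)) +
         ?K * ln ((1 + \<alpha> * ?\<rho> + \<beta>) / (1 + \<alpha> * ?\<rho> + \<beta> * ?q))"
    using tilt_parameters_deviation[OF q \<rho> \<eta>] x unfolding walk_lambda_eq walk_m_eq by auto
  define \<sigma> where "\<sigma> = ln ((1 + \<alpha> + \<beta> * ?\<rho>) / (1 + \<alpha> * ?q + \<beta> * ?\<rho>))"
  define \<tau> where "\<tau> = ln ((1 + \<alpha> * ?\<rho> + \<beta>) / (1 + \<alpha> * ?\<rho> + \<beta> * ?q))"
  have \<sigma>: "0 < \<sigma>"
  proof -
    have "- (\<alpha> * ?q) \<le> \<beta> * ?\<rho>"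
    proof (cases "0 \<le> \<beta>")
      case True
      then have "0 \<le> \<beta> * ?\<rho>" "0 \<le> \<alpha> * ?q" using \<rho> \<alpha>\<beta>(1) q by simp_all
      then show ?thesis by linarith
    next
      case False
      then have "\<beta> * 1 \<le> \<beta> * ?\<rho>" using \<rho> by (intro mult_left_mono_neg) auto
      then show ?thesis using \<alpha>\<beta>(3) False by linarith
    qed
    moreover have "\<alpha> * ?q < \<alpha>" using q \<alpha>\<beta>(1) by simp
    ultimately show ?thesis unfolding \<sigma>_def by (intro ln_gt_zero) simp
  qed
  have sgn_\<tau>: "sgn \<tau> = sgn \<eta>"
  proof -
    have \<alpha>\<rho>: "0 < \<alpha> * ?\<rho>" using \<alpha>\<beta>(1) \<rho> by simp
    show ?thesis
    proof (cases "0 < \<eta>")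
      case True
      then have b: "0 < \<beta>" using \<alpha>\<beta>(4) by (simp add: sgn_if split: if_splits)
      then have "0 < \<beta> * ?q" "\<beta> * ?q < \<beta>" using q by simp_all
      then have "0 < \<tau>" unfolding \<tau>_def using \<alpha>\<rho> by (intro ln_gt_zero) simp
      then show ?thesis using True by simp
    next
      case False
      then have b: "\<beta> < 0" using \<alpha>\<beta>(4) \<eta> by (simp add: sgn_if split: if_splits)
      then have "\<beta> < \<beta> * ?q" using q by simp
      moreover have "0 < 1 + \<alpha> * ?\<rho> + \<beta>" using \<alpha>\<beta>(2) by linarith
      ultimately have "\<tau> < 0" unfolding \<tau>_def by (intro ln_less_zero) auto
      then show ?thesis using False \<eta> by simp
    qed
  qed
  \<comment> \<open>The excess over \<open>1\<close> pays for the constant \<open>c > 1\<close> and for the vanishing \<open>\<epsilon> n\<close>.\<close>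
  define gap where "gap = \<Lambda> * \<sigma> + ?K * \<tau> - 1"
  have gap: "0 < gap" using gt by (simp add: gap_def \<sigma>_def \<tau>_def)
  have "(\<lambda>n. \<epsilon> n * (\<Lambda> * \<sigma>)) \<longlonglongrightarrow> 0 * (\<Lambda> * \<sigma>)" by (intro tendsto_intros \<epsilon>)
  then have small: "eventually (\<lambda>n. \<epsilon> n * (\<Lambda> * \<sigma>) < gap / 2) sequentially"
    using gap by (intro order_tendstoD(2)) auto
  have "AE \<omega> in M. eventually (\<lambda>n. \<forall>j\<le>n. \<forall>m. \<sigma> * local_time X (walk X j \<omega>) m \<omega> +
           \<tau> * local_time X (x + walk X j \<omega>) m \<omega> \<le> (1 + gap / 2) * ln (real n)) sequentially"
    unfolding \<sigma>_def \<tau>_def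
    by (rule AE_local_times_tilted[OF x]) (use \<alpha>\<beta> gap in auto)
  then show ?thesis
  proof eventually_elim
    case (elim \<omega>)
    then show ?case using small eventually_ge_at_top[of 1]
    proof eventually_elim
      case (elim n)
      have ln: "0 \<le> ln (real n)" using elim by simp
      show ?case
      proof (intro allI impI)
        fix j m
        assume j: "j \<le> n" and heavy: "(1 - \<epsilon> n) * \<Lambda> * ln (real n) \<le> local_time X (walk X j \<omega>) m \<omega>"
        let ?V = "local_time X (x + walk X j \<omega>) m \<omega>"
        have "\<sigma> * ((1 - \<epsilon> n) * \<Lambda> * ln (real n)) \<le> \<sigma> * local_time X (walk X j \<omega>) m \<omega>"
          using heavy \<sigma> by (intro mult_left_mono) auto
        moreover have "\<sigma> * local_time X (walk X j \<omega>) m \<omega> + \<tau> * ?V \<le> (1 + gap / 2) * ln (real n)"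
          using elim(1) j by blast
        ultimately have "\<tau> * ?V \<le> (1 + gap / 2) * ln (real n) - \<sigma> * ((1 - \<epsilon> n) * \<Lambda> * ln (real n))"
          by linarith
        also have "\<dots> = (1 + gap / 2 - \<Lambda> * \<sigma> + \<epsilon> n * (\<Lambda> * \<sigma>)) * ln (real n)"
          by (simp add: algebra_simps)
        also have "\<dots> \<le> (?K * \<tau>) * ln (real n)"
          using elim(2) gap_def by (intro mult_right_mono[OF _ ln]) linarith
        finally have "\<tau> * ?V \<le> \<tau> * (?K * ln (real n))" by (simp add: mult_ac)
        then have "\<bar>\<tau>\<bar> * (sgn \<eta> * ?V) \<le> \<bar>\<tau>\<bar> * (sgn \<eta> * (?K * ln (real n)))"
          by (simp flip: sgn_\<tau> mult.assoc add: abs_mult_sgn)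
        moreover have "0 < \<bar>\<tau>\<bar>" using sgn_\<tau> \<eta> by (auto simp: sgn_if split: if_splits)
        ultimately show "sgn \<eta> * ?V \<le> sgn \<eta> * (?K * ln (real n))" by simp
      qed
    qed
  qed
qed

text \<open>For \<open>x = 0\<close> the lower bound is the assumed heaviness itself, and only the upper bound has
probabilistic content.\<close>

theorem AE_uniform_local_times:
  assumes \<epsilon>: "\<epsilon> \<longlonglongrightarrow> 0" and e: "0 < e"
  shows "AE \<omega> in M. eventually (\<lambda>n. \<forall>j\<le>n. \<forall>m.
           (1 - \<epsilon> n) * \<Lambda> * ln (real n) \<le> local_time X (walk X j \<omega>) m \<omega> \<longrightarrow>
           \<bar>local_time X (x + walk X j \<omega>) m \<omega> - \<Lambda> * walk_m M X x * ln (real n)\<bar> \<le> e * ln (real n)) sequentially"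
proof (cases "x = 0")
  case True
  have "(\<lambda>n. \<epsilon> n * \<Lambda>) \<longlonglongrightarrow> 0 * \<Lambda>" by (intro tendsto_intros \<epsilon>)
  then have small: "eventually (\<lambda>n. \<epsilon> n * \<Lambda> < e) sequentially"
    using e by (intro order_tendstoD(2)) auto
  show ?thesis
    using AE_local_time_upper[OF e]
  proof eventually_elim
    case (elim \<omega>)
    then show ?case using small eventually_ge_at_top[of 1]
    proof eventually_elim
      case (elim n)
      have "0 \<le> ln (real n)" using elim by simp
      then have "\<epsilon> n * \<Lambda> * ln (real n) \<le> e * ln (real n)" using elim by (intro mult_right_mono) auto
      then show ?case using elim(1) True
        by (auto simp: walk_m_eq abs_le_iff algebra_simps)
    qed
  qed
next
  case False
  have "e \<noteq> 0" "- e \<noteq> 0" using e by auto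
  from AE_shifted_local_time[OF False this(1) \<epsilon>] AE_shifted_local_time[OF False this(2) \<epsilon>]
  show ?thesis
  proof eventually_elim
    case (elim \<omega>)
    then show ?case
    proof eventually_elim
      case (elim n)
      then show ?case using e by (auto simp: abs_le_iff algebra_simps)
    qed
  qed
qed

end

section \<open>Limits along heavy points and heavy times\<close>

lemma total_local_time_eq_SUP: "total_local_time X x \<omega> = (SUP n. ereal (local_time X x n \<omega>))"
proof -
  have "total_local_time X x \<omega> = (SUP n. \<Sum>k<n. of_bool (walk X (Suc k) \<omega> = x))"
    unfolding total_local_time_def by (rule suminf_ereal_eq_SUP) simp
  also have "(\<lambda>n. \<Sum>k<n. of_bool (walk X (Suc k) \<omega> = x) :: ereal) = (\<lambda>n. ereal (local_time X x n \<omega>))"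
  proof
    fix n
    have "local_time X x n \<omega> = (\<Sum>k<n. of_bool (walk X (Suc k) \<omega> = x))"
      unfolding local_time_def
      by (rule sum.reindex_bij_witness[of _ Suc "\<lambda>k. k - 1"]) auto
    moreover have "of_bool b = ereal (of_bool b)" for b by (cases b) (auto simp: zero_ereal_def one_ereal_def)
    ultimately show "(\<Sum>k<n. of_bool (walk X (Suc k) \<omega> = x) :: ereal) = ereal (local_time X x n \<omega>)"
      by simp
  qed
  finally show ?thesis .
qed

lemma local_time_mono: "m \<le> n \<Longrightarrow> local_time X x m \<omega> \<le> local_time X x n \<omega>"
  unfolding local_time_def by (rule sum_mono2) auto

lemma local_time_pos_visited:
  assumes "0 < local_time X x n \<omega>"
  obtains k where "k \<le> n" "walk X k \<omega> = x"
proof -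
  have "\<exists>k\<in>{1..n}. walk X k \<omega> = x"
  proof (rule ccontr)
    assume "\<not> ?thesis"
    then have "local_time X x n \<omega> = 0" unfolding local_time_def by (intro sum.neutral) auto
    then show False using assms by simp
  qed
  then show ?thesis using that by auto
qed

lemma tendsto_along_nonempty_sum:
  fixes f :: "'i \<Rightarrow> nat \<Rightarrow> real"
  assumes bound: "\<And>x e. x \<in> A \<Longrightarrow> 0 < e \<Longrightarrow>
      eventually (\<lambda>n. H n \<noteq> {} \<longrightarrow> \<bar>f x n - l x * ln (real n)\<bar> \<le> e * ln (real n)) sequentially"
  shows "tendsto_along_nonempty (\<lambda>n. (\<Sum>x\<in>A. f x n) / ln (real n)) (\<Sum>x\<in>A. l x) H"
  unfolding tendsto_along_nonempty_def sum_divide_distrib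
proof (rule tendsto_sum)
  fix x assume x: "x \<in> A"
  show "((\<lambda>n. f x n / ln (real n)) \<longlongrightarrow> l x) (inf sequentially (principal {n. H n \<noteq> {}}))"
  proof (rule tendstoI)
    fix e :: real assume e: "0 < e"
    then have "0 < e / 2" by simp
    have "eventually (\<lambda>n. n \<in> {n. H n \<noteq> {}} \<longrightarrow> dist (f x n / ln (real n)) (l x) < e) sequentially"
      using bound[OF x \<open>0 < e / 2\<close>] eventually_ge_at_top[of 2]
    proof eventually_elim
      case (elim n)
      have ln: "0 < ln (real n)" using elim by simp
      have "dist (f x n / ln (real n)) (l x) = \<bar>f x n - l x * ln (real n)\<bar> / ln (real n)"
      proof -
        have "f x n / ln (real n) - l x = (f x n - l x * ln (real n)) / ln (real n)"
          using ln by (simp add: field_simps)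
        then show ?thesis using ln by (simp add: dist_real_def abs_divide)
      qed
      show ?case
      proof
        assume "n \<in> {n. H n \<noteq> {}}"
        then have "\<bar>f x n - l x * ln (real n)\<bar> / ln (real n) \<le> e / 2"
          using elim(1) ln by (simp add: divide_le_eq)
        then show "dist (f x n / ln (real n)) (l x) < e"
          using \<open>dist _ _ = _\<close> e by linarith
      qed
    qed
    then show "eventually (\<lambda>n. dist (f x n / ln (real n)) (l x) < e)
        (inf sequentially (principal {n. H n \<noteq> {}}))"
      by (simp add: eventually_inf_principal)
  qed
qed

context transient_walk
begin

lemma AE_uniform_local_times_all:
  assumes \<epsilon>: "\<epsilon> \<longlonglongrightarrow> 0"
  shows "AE \<omega> in M. \<forall>x. \<forall>e>0. eventually (\<lambda>n. \<forall>j\<le>n. \<forall>m.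
           (1 - \<epsilon> n) * \<Lambda> * ln (real n) \<le> local_time X (walk X j \<omega>) m \<omega> \<longrightarrow>
           \<bar>local_time X (x + walk X j \<omega>) m \<omega> - \<Lambda> * walk_m M X x * ln (real n)\<bar> \<le> e * ln (real n)) sequentially"
    (is "AE \<omega> in M. \<forall>x. \<forall>e>0. ?P \<omega> x e")
proof -
  have "AE \<omega> in M. \<forall>x. \<forall>k. ?P \<omega> x (1 / real (Suc k))"
    unfolding AE_all_countable by (intro allI AE_uniform_local_times[OF \<epsilon>]) simp
  then show ?thesis
  proof eventually_elim
    case (elim \<omega>)
    show ?case
    proof (intro allI impI)
      fix x and e :: real assume "0 < e"
      then obtain k where k: "1 / real (Suc k) < e" using nat_approx_posE by metis
      from elim have "?P \<omega> x (1 / real (Suc k))" by blast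
      then show "?P \<omega> x e"
        using eventually_ge_at_top[of 1]
      proof eventually_elim
        case (elim n)
        have "1 / real (Suc k) * ln (real n) \<le> e * ln (real n)"
          using k elim(2) by (intro mult_right_mono) auto
        then show ?case using elim(1) order_trans by blast
      qed
    qed
  qed
qed

text \<open>A heavy point has positive local time, hence is the position of the walk at some time up to \<open>n\<close>, and
the uniform estimate applies with the local times stopped at \<open>n\<close>.\<close>

lemma heavy_points_limit:
  assumes \<delta>: "\<delta> \<longlonglongrightarrow> 0"
  shows "AE \<omega> in M. \<forall>z. (\<forall>n. heavy_points M X \<delta> n \<omega> \<noteq> {} \<longrightarrow> z n \<in> heavy_points M X \<delta> n \<omega>) \<longrightarrow>
          tendsto_along_nonempty
            (\<lambda>n. (\<Sum>x\<in>A. local_time X (x + z n) n \<omega>) / ln (real n))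
            (\<Lambda> * (\<Sum>x\<in>A. walk_m M X x))
            (\<lambda>n. heavy_points M X \<delta> n \<omega>)"
  using AE_uniform_local_times_all[OF \<delta>]
proof eventually_elim
  case (elim \<omega>)
  show ?case
    unfolding sum_distrib_left
  proof (intro allI impI tendsto_along_nonempty_sum)
    fix z x and e :: real
    assume z: "\<forall>n. heavy_points M X \<delta> n \<omega> \<noteq> {} \<longrightarrow> z n \<in> heavy_points M X \<delta> n \<omega>" and e: "0 < e"
    have "eventually (\<lambda>n. \<delta> n < 1) sequentially" using \<delta> by (intro order_tendstoD(2)) auto
    with elim[rule_format, OF e, of x] eventually_ge_at_top[of 2]
    show "eventually (\<lambda>n. heavy_points M X \<delta> n \<omega> \<noteq> {} \<longrightarrow>
        \<bar>local_time X (x + z n) n \<omega> - \<Lambda> * walk_m M X x * ln (real n)\<bar> \<le> e * ln (real n)) sequentially"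
    proof eventually_elim
      case (elim n)
      show ?case
      proof
        assume "heavy_points M X \<delta> n \<omega> \<noteq> {}"
        then have "z n \<in> heavy_points M X \<delta> n \<omega>" using z by blast
        then have heavy: "(1 - \<delta> n) * \<Lambda> * ln (real n) \<le> local_time X (z n) n \<omega>"
          by (simp add: heavy_points_def heavy_level_def)
        moreover have "0 < (1 - \<delta> n) * \<Lambda> * ln (real n)"
          using elim walk_lambda_pos by simp
        ultimately have "0 < local_time X (z n) n \<omega>" by linarith
        then obtain j where "j \<le> n" "walk X j \<omega> = z n" by (rule local_time_pos_visited)
        then show "\<bar>local_time X (x + z n) n \<omega> - \<Lambda> * walk_m M X x * ln (real n)\<bar> \<le> e * ln (real n)"
          using elim(1)[rule_format, of j n] heavy by simp
      qed
    qed
  qed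
qed

text \<open>The total local time is a supremum that a priori may be infinite or not attained. Relaxing \<open>\<delta>\<^sub>n\<close> to
\<open>2\<delta>\<^sub>n\<close> lowers the level strictly, so some finite time already exceeds it. From then on the uniform
estimate bounds the local times at \<open>x + z\<close>, and their supremum is finite and obeys the same bounds.\<close>

lemma heavy_times_limit:
  assumes \<delta>: "\<delta> \<longlonglongrightarrow> 0" and \<delta>_pos: "\<And>n. n \<ge> 1 \<Longrightarrow> 0 < \<delta> n"
  shows "AE \<omega> in M. \<forall>j. (\<forall>n. heavy_times M X \<delta> n \<omega> \<noteq> {} \<longrightarrow> j n \<in> heavy_times M X \<delta> n \<omega>) \<longrightarrow>
          tendsto_along_nonempty
            (\<lambda>n. (\<Sum>x\<in>A. total_local_time X (x + walk X (j n) \<omega>) \<omega>) / ereal (ln (real n)))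
            (ereal (\<Lambda> * (\<Sum>x\<in>A. walk_m M X x)))
            (\<lambda>n. heavy_times M X \<delta> n \<omega>)"
proof -
  have "(\<lambda>n. 2 * \<delta> n) \<longlonglongrightarrow> 2 * 0" by (intro tendsto_intros \<delta>)
  then have \<delta>2: "(\<lambda>n. 2 * \<delta> n) \<longlonglongrightarrow> 0" by simp
  show ?thesis
    using AE_uniform_local_times_all[OF \<delta>2]
  proof eventually_elim
    case (elim \<omega>)
    show ?case
    proof (intro allI impI)
      fix j
      assume j: "\<forall>n. heavy_times M X \<delta> n \<omega> \<noteq> {} \<longrightarrow> j n \<in> heavy_times M X \<delta> n \<omega>"
      define H where "H n = heavy_times M X \<delta> n \<omega>" for n
      define T where "T x n = total_local_time X (x + walk X (j n) \<omega>) \<omega>" for x n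
      have key: "eventually (\<lambda>n. H n \<noteq> {} \<longrightarrow> \<bar>T x n\<bar> \<noteq> \<infinity> \<and>
          \<bar>real_of_ereal (T x n) - \<Lambda> * walk_m M X x * ln (real n)\<bar> \<le> e * ln (real n)) sequentially"
        if e: "0 < e" for x e
        using elim[rule_format, OF e, of x] eventually_ge_at_top[of 2]
      proof eventually_elim
        case (elim n)
        show ?case
        proof
          assume "H n \<noteq> {}"
          then have jn: "j n \<le> n" and total: "ereal ((1 - \<delta> n) * \<Lambda> * ln (real n)) \<le>
              total_local_time X (walk X (j n) \<omega>) \<omega>"
            using j[rule_format, of n] by (simp_all add: H_def heavy_times_def heavy_level_def)
          have "0 < \<delta> n * (\<Lambda> * ln (real n))" using elim(2) \<delta>_pos[of n] walk_lambda_pos by simp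
          then have "(1 - 2 * \<delta> n) * \<Lambda> * ln (real n) < (1 - \<delta> n) * \<Lambda> * ln (real n)"
            by (simp add: algebra_simps)
          then have "ereal ((1 - 2 * \<delta> n) * \<Lambda> * ln (real n)) <
              (SUP m. ereal (local_time X (walk X (j n) \<omega>) m \<omega>))"
            using total unfolding total_local_time_eq_SUP by (meson less_ereal.simps(1) less_le_trans)
          then obtain m0 where m0: "(1 - 2 * \<delta> n) * \<Lambda> * ln (real n) < local_time X (walk X (j n) \<omega>) m0 \<omega>"
            by (auto simp: less_SUP_iff)
          let ?a = "\<Lambda> * walk_m M X x * ln (real n)" and ?V = "\<lambda>m. local_time X (x + walk X (j n) \<omega>) m \<omega>"
          have V: "\<bar>?V m - ?a\<bar> \<le> e * ln (real n)" if "m0 \<le> m" for m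
          proof -
            have "(1 - 2 * \<delta> n) * \<Lambda> * ln (real n) \<le> local_time X (walk X (j n) \<omega>) m \<omega>"
              using m0 local_time_mono[OF that, of X "walk X (j n) \<omega>" \<omega>] by linarith
            then show ?thesis using elim(1) jn by blast
          qed
          have upper: "T x n \<le> ereal (?a + e * ln (real n))"
            unfolding T_def total_local_time_eq_SUP
          proof (rule SUP_least)
            fix m
            have "?V m \<le> ?V (max m m0)" by (rule local_time_mono) simp
            also have "\<dots> \<le> ?a + e * ln (real n)" using V[of "max m m0"] by (simp add: abs_le_iff)
            finally show "ereal (?V m) \<le> ereal (?a + e * ln (real n))" by simp
          qed
          have "ereal (?a - e * ln (real n)) \<le> ereal (?V m0)" using V[of m0] by (simp add: abs_le_iff)
          also have "\<dots> \<le> T x n" unfolding T_def total_local_time_eq_SUP by (rule SUP_upper) simp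
          finally have lower: "ereal (?a - e * ln (real n)) \<le> T x n" .
          from upper lower show "\<bar>T x n\<bar> \<noteq> \<infinity> \<and> \<bar>real_of_ereal (T x n) - ?a\<bar> \<le> e * ln (real n)"
            by (cases "T x n") (auto simp: abs_le_iff)
        qed
      qed
      have fin: "eventually (\<lambda>n. H n \<noteq> {} \<longrightarrow> \<bar>T x n\<bar> \<noteq> \<infinity>) sequentially" for x
        using key[OF zero_less_one, of x] by eventually_elim auto
      have lim: "tendsto_along_nonempty (\<lambda>n. (\<Sum>x\<in>A. real_of_ereal (T x n)) / ln (real n))
          (\<Sum>x\<in>A. \<Lambda> * walk_m M X x) H"
      proof (rule tendsto_along_nonempty_sum)
        fix x and e :: real assume "0 < e"
        from key[OF this, of x] show "eventually (\<lambda>n. H n \<noteq> {} \<longrightarrow>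
          \<bar>real_of_ereal (T x n) - \<Lambda> * walk_m M X x * ln (real n)\<bar> \<le> e * ln (real n)) sequentially"
          by eventually_elim auto
      qed
      have "eventually (\<lambda>n. H n \<noteq> {} \<longrightarrow> (\<Sum>x\<in>A. T x n) / ereal (ln (real n)) =
          ereal ((\<Sum>x\<in>A. real_of_ereal (T x n)) / ln (real n))) sequentially"
      proof (cases "finite A")
        case True
        then have "eventually (\<lambda>n. \<forall>x\<in>A. H n \<noteq> {} \<longrightarrow> \<bar>T x n\<bar> \<noteq> \<infinity>) sequentially"
          by (rule eventually_ball_finite) (use fin in blast)
        then show ?thesis using eventually_ge_at_top[of 2]
        proof eventually_elim
          case (elim n)
          show ?case
          proof
            assume "H n \<noteq> {}"
            then have "(\<Sum>x\<in>A. T x n) = (\<Sum>x\<in>A. ereal (real_of_ereal (T x n)))"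
              using elim(1) by (intro sum.cong refl) (auto simp: ereal_real)
            then show "(\<Sum>x\<in>A. T x n) / ereal (ln (real n)) =
                ereal ((\<Sum>x\<in>A. real_of_ereal (T x n)) / ln (real n))"
              using elim(2) by simp
          qed
        qed
      next
        case False
        then show ?thesis using eventually_ge_at_top[of 2] by (auto elim!: eventually_mono)
      qed
      then have "eventually (\<lambda>n. ereal ((\<Sum>x\<in>A. real_of_ereal (T x n)) / ln (real n)) =
          (\<Sum>x\<in>A. T x n) / ereal (ln (real n))) (inf sequentially (principal {n. H n \<noteq> {}}))"
        by (simp add: eventually_inf_principal eq_commute)
      then have "((\<lambda>n. (\<Sum>x\<in>A. T x n) / ereal (ln (real n))) \<longlongrightarrow>
          ereal (\<Sum>x\<in>A. \<Lambda> * walk_m M X x)) (inf sequentially (principal {n. H n \<noteq> {}}))"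
        using lim unfolding tendsto_along_nonempty_def
        by (intro Lim_transform_eventually[OF tendsto_ereal])
      then show "tendsto_along_nonempty
          (\<lambda>n. (\<Sum>x\<in>A. total_local_time X (x + walk X (j n) \<omega>) \<omega>) / ereal (ln (real n)))
          (ereal (\<Lambda> * (\<Sum>x\<in>A. walk_m M X x))) (\<lambda>n. heavy_times M X \<delta> n \<omega>)"
        by (simp only: tendsto_along_nonempty_def T_def H_def sum_distrib_left)
    qed
  qed
qed

end

text \<open>A nondecreasing positive sequence is bounded away from zero, so the decay must come from the other factor.\<close>

lemma tendsto_0_of_mult_mono_power:
  fixes r \<delta> :: "nat \<Rightarrow> real"
  assumes "\<And>n. n \<ge> 1 \<Longrightarrow> r n > 0" "\<And>n. n \<ge> 1 \<Longrightarrow> \<delta> n > 0" "mono_on {1..} r"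
    and "(\<lambda>n. \<delta> n * r n ^ k) \<longlonglongrightarrow> 0"
  shows "\<delta> \<longlonglongrightarrow> 0"
proof (rule tendsto_sandwich)
  show "eventually (\<lambda>n. 0 \<le> \<delta> n) sequentially"
    using eventually_ge_at_top[of 1] by eventually_elim (use assms(2) in \<open>simp add: less_imp_le\<close>)
  show "eventually (\<lambda>n. \<delta> n \<le> \<delta> n * r n ^ k / r 1 ^ k) sequentially"
    using eventually_ge_at_top[of 1]
  proof eventually_elim
    case (elim n)
    have "0 < r 1" using assms(1)[of 1] by simp
    moreover have "r 1 \<le> r n" using elim by (intro mono_onD[OF assms(3)]) auto
    ultimately have "r 1 ^ k \<le> r n ^ k" "0 < r 1 ^ k" by (auto intro: power_mono)
    then have "\<delta> n * r 1 ^ k \<le> \<delta> n * r n ^ k"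
      using assms(2)[OF elim] by (intro mult_left_mono) auto
    then show ?case using \<open>0 < r 1 ^ k\<close> by (simp add: field_simps)
  qed
  show "(\<lambda>n. \<delta> n * r n ^ k / r 1 ^ k) \<longlonglongrightarrow> 0"
    using tendsto_divide[OF assms(4) tendsto_const[of "r 1 ^ k"]] assms(1)[of 1] by simp
qed simp

theorem corollary1p1:
  fixes M :: "'w measure"
    and X :: "nat \<Rightarrow> 'w \<Rightarrow> int ^ 'd"
    and p :: "(int ^ 'd) pmf"
    and A :: "(int ^ 'd) set"
    and r \<delta> :: "nat \<Rightarrow> real"
  assumes "iid_steps M X p"
    and "symmetric_step p"
    and "aperiodic_walk M X"
    and "moment_condition p"
    and "finite A"
    and "\<And>n. n \<ge> 1 \<Longrightarrow> r n > 0"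
    and "\<And>n. n \<ge> 1 \<Longrightarrow> \<delta> n > 0"
    and "antimono_on {1..} \<delta>"
    and "mono_on {1..} r"
    and "\<And>c::real. c > 0 \<Longrightarrow>
           \<exists>C>0. \<forall>n\<ge>1. nat \<lfloor>c * real n\<rfloor> \<ge> 1 \<longrightarrow> r (nat \<lfloor>c * real n\<rfloor>) / r n < C"
    and "(\<lambda>n. r n ^ (2 * CARD('d) - 4) * (ln (ln (real n)) / ln (real n))) \<longlonglongrightarrow> 0"
    and "(\<lambda>n. \<delta> n * r n ^ (2 * CARD('d) - 4)) \<longlonglongrightarrow> 0"
  shows
    "(CARD('d) \<ge> 5 \<longrightarrow>
       (AE \<omega> in M. \<forall>z :: nat \<Rightarrow> int ^ 'd.
          (\<forall>n. heavy_points M X \<delta> n \<omega> \<noteq> {} \<longrightarrow> z n \<in> heavy_points M X \<delta> n \<omega>) \<longrightarrow>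
          tendsto_along_nonempty
            (\<lambda>n. (\<Sum>x\<in>A. local_time X (x + z n) n \<omega>) / ln (real n))
            (walk_lambda M X * (\<Sum>x\<in>A. walk_m M X x))
            (\<lambda>n. heavy_points M X \<delta> n \<omega>))) \<and>
     (CARD('d) \<ge> 3 \<longrightarrow>
       (AE \<omega> in M. \<forall>j :: nat \<Rightarrow> nat.
          (\<forall>n. heavy_times M X \<delta> n \<omega> \<noteq> {} \<longrightarrow> j n \<in> heavy_times M X \<delta> n \<omega>) \<longrightarrow>
          tendsto_along_nonempty
            (\<lambda>n. (\<Sum>x\<in>A. total_local_time X (x + walk X (j n) \<omega>) \<omega>) / ereal (ln (real n)))
            (ereal (walk_lambda M X * (\<Sum>x\<in>A. walk_m M X x)))
            (\<lambda>n. heavy_times M X \<delta> n \<omega>)))"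
proof -
  have \<delta>: "\<delta> \<longlonglongrightarrow> 0" by (rule tendsto_0_of_mult_mono_power[OF assms(6,7,9,12)])
  have walk: "transient_walk M X p" if "CARD('d) \<ge> 3"
    using assms(1) iid_steps.generating_of_aperiodic[OF assms(1-3)] that
    by (simp add: transient_walk_def transient_walk_axioms_def)
  show ?thesis
  proof (intro conjI impI)
    assume "CARD('d) \<ge> 5"
    then interpret transient_walk M X p by (intro walk) simp
    show "AE \<omega> in M. \<forall>z :: nat \<Rightarrow> int ^ 'd.
          (\<forall>n. heavy_points M X \<delta> n \<omega> \<noteq> {} \<longrightarrow> z n \<in> heavy_points M X \<delta> n \<omega>) \<longrightarrow>
          tendsto_along_nonempty
            (\<lambda>n. (\<Sum>x\<in>A. local_time X (x + z n) n \<omega>) / ln (real n))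
            (walk_lambda M X * (\<Sum>x\<in>A. walk_m M X x))
            (\<lambda>n. heavy_points M X \<delta> n \<omega>)"
      by (rule heavy_points_limit[OF \<delta>])
  next
    assume "CARD('d) \<ge> 3"
    then interpret transient_walk M X p by (rule walk)
    show "AE \<omega> in M. \<forall>j :: nat \<Rightarrow> nat.
          (\<forall>n. heavy_times M X \<delta> n \<omega> \<noteq> {} \<longrightarrow> j n \<in> heavy_times M X \<delta> n \<omega>) \<longrightarrow>
          tendsto_along_nonempty
            (\<lambda>n. (\<Sum>x\<in>A. total_local_time X (x + walk X (j n) \<omega>) \<omega>) / ereal (ln (real n)))
            (ereal (walk_lambda M X * (\<Sum>x\<in>A. walk_m M X x)))
            (\<lambda>n. heavy_times M X \<delta> n \<omega>)"
      by (rule heavy_times_limit[OF \<delta> assms(7)])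
  qed
qed

end
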